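(* Let $T$ be a $2$-dependent theory with monster model $\mathbb{M}$, let $\kappa\geq|T|$ be an infinite cardinal, and let $\lambda>\kappa$ be a regular cardinal. Then for any mutually indiscernible sequences $I=(a_i:i\in\kappa)$, $J=(b_j:j\in\lambda)$ of finite tuples and a finite tuple $c$ (all in $\mathbb{M}$), there is some $\beta\in\lambda$ such that $$|S_{J_{>\beta}}(I\times\{c\})|\leq(\mathrm{ded}\,\kappa)^{|T|}.$$
   Context: $T$ is a complete theory in a language $\mathcal{L}$ and $\mathbb{M}\models T$ is a monster model (saturated and homogeneous for a sufficiently large strongly inaccessible cardinal, larger than $\kappa$ and $\lambda$). $J_{>\beta}:=\{b_j:j\in\lambda,\ j>\beta\}$. For sets of tuples $B\subseteq\mathbb{M}_x$ and $A\subseteq\mathbb{M}_y$ ($\mathbb{M}_x$ denotes the product of sorts corresponding to the tuple of variables $x$), $S_B(A)$ denotes the set of all complete types over $A$ realized in $B$, i.e. $\{\mathrm{tp}(b/A):b\in B\}$. For an infinite cardinal $\kappa$, $\mathrm{ded}\,\kappa$ is the supremum of the number of Dedekind cuts among all linear orders of cardinality $\kappa$. Sequences $I,J$ are mutually indiscernible if each is indiscernible over the other. A partitioned formula $\varphi(x;y_1,y_2)$ is not $2$-dependent (with respect to $T$) if in some model of $T$ there are tuples $(a_{1,i},a_{2,i})_{i\in\omega}$ such that for every $s\subseteq\omega^2$ there is a tuple $e_s$ with $\models\varphi(e_s;a_{1,i_1},a_{2,i_2})\Leftrightarrow(i_1,i_2)\in s$; otherwise it is $2$-dependent. $T$ is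 $2$-dependent if every formula is. *)

theory Defs
  imports Main
begin

unbundle cardinal_syntax

section \<open>Many-sorted first-order logic\<close>

text \<open>
  The symbols of a language are carved out of the types \<^typ>\<open>'s\<close>, \<^typ>\<open>'f\<close>, \<^typ>\<open>'r\<close> by sets, so
  that languages without relation symbols, say, are covered. Constants are nullary functions.
\<close>

record ('s, 'f, 'r) lang =
  sorts :: "'s set"
  funs :: "'f set"
  rels :: "'r set"
  fun_args :: "'f \<Rightarrow> 's list"
  fun_sort :: "'f \<Rightarrow> 's"
  rel_args :: "'r \<Rightarrow> 's list"

definition is_lang :: "('s, 'f, 'r) lang \<Rightarrow> bool" where
  "is_lang L \<longleftrightarrow>
     (\<forall>f\<in>funs L. set (fun_args L f) \<subseteq> sorts L \<and> fun_sort L f \<in> sorts L) \<and>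
     (\<forall>r\<in>rels L. set (rel_args L r) \<subseteq> sorts L)"

datatype 'f tm = Var nat | App 'f "'f tm list"

text \<open>
  Variables are de Bruijn indices. A tuple of variables is represented by the list of its sorts
  (a context), and concatenation of contexts is concatenation of tuples of variables: a partitioned
  formula \<open>\<phi>(x; y)\<close> with \<open>x\<close> of sorts \<open>X\<close> and \<open>y\<close> of sorts \<open>Y\<close> is a formula
  in context \<open>X @ Y\<close>. The quantifier \<open>Exists s\<close> binds index 0, of sort \<open>s\<close>.
\<close>

datatype ('s, 'f, 'r) fm =
    Bot
  | Eq "'f tm" "'f tm"
  | Rel 'r "'f tm list"
  | Neg "('s, 'f, 'r) fm"
  | Conj "('s, 'f, 'r) fm" "('s, 'f, 'r) fm"
  | Exists 's "('s, 'f, 'r) fm"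

inductive has_sort :: "('s, 'f, 'r) lang \<Rightarrow> 's list \<Rightarrow> 'f tm \<Rightarrow> 's \<Rightarrow> bool"
  for L :: "('s, 'f, 'r) lang" and \<Gamma> :: "'s list" where
  "n < length \<Gamma> \<Longrightarrow> has_sort L \<Gamma> (Var n) (\<Gamma> ! n)"
| "f \<in> funs L \<Longrightarrow> list_all2 (has_sort L \<Gamma>) ts (fun_args L f) \<Longrightarrow>
     has_sort L \<Gamma> (App f ts) (fun_sort L f)"
monos list.rel_mono

primrec well_sorted :: "('s, 'f, 'r) lang \<Rightarrow> 's list \<Rightarrow> ('s, 'f, 'r) fm \<Rightarrow> bool" where
  "well_sorted L \<Gamma> Bot \<longleftrightarrow> True"
| "well_sorted L \<Gamma> (Eq t u) \<longleftrightarrow> (\<exists>s. has_sort L \<Gamma> t s \<and> has_sort L \<Gamma> u s)"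
| "well_sorted L \<Gamma> (Rel r ts) \<longleftrightarrow> r \<in> rels L \<and> list_all2 (has_sort L \<Gamma>) ts (rel_args L r)"
| "well_sorted L \<Gamma> (Neg \<phi>) \<longleftrightarrow> well_sorted L \<Gamma> \<phi>"
| "well_sorted L \<Gamma> (Conj \<phi> \<psi>) \<longleftrightarrow> well_sorted L \<Gamma> \<phi> \<and> well_sorted L \<Gamma> \<psi>"
| "well_sorted L \<Gamma> (Exists s \<phi>) \<longleftrightarrow> s \<in> sorts L \<and> well_sorted L (s # \<Gamma>) \<phi>"

definition formulas :: "('s, 'f, 'r) lang \<Rightarrow> 's list \<Rightarrow> ('s, 'f, 'r) fm set" where
  "formulas L \<Gamma> = {\<phi>. set \<Gamma> \<subseteq> sorts L \<and> well_sorted L \<Gamma> \<phi>}"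

abbreviation sentences :: "('s, 'f, 'r) lang \<Rightarrow> ('s, 'f, 'r) fm set" where
  "sentences L \<equiv> formulas L []"

section \<open>Structures\<close>

record ('s, 'f, 'r, 'm) struc =
  sort_dom :: "'s \<Rightarrow> 'm set"
  fun_int :: "'f \<Rightarrow> 'm list \<Rightarrow> 'm"
  rel_int :: "'r \<Rightarrow> 'm list \<Rightarrow> bool"

text \<open>For a context \<open>X\<close>, \<open>tuples M X\<close> is the product of sorts written \<open>M\<^sub>x\<close>.\<close>

definition tuples :: "('s, 'f, 'r, 'm) struc \<Rightarrow> 's list \<Rightarrow> 'm list set" where
  "tuples M X = {as. list_all2 (\<lambda>a s. a \<in> sort_dom M s) as X}"

definition elems :: "('s, 'f, 'r, 'm) struc \<Rightarrow> 'm set" where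
  "elems M = (\<Union>s. sort_dom M s)"

text \<open>
  Sorts are nonempty and pairwise disjoint, so that an element determines its sort. Relation and
  function interpretations are irrelevant outside of the arguments of the right sorts.
\<close>

definition is_struc :: "('s, 'f, 'r) lang \<Rightarrow> ('s, 'f, 'r, 'm) struc \<Rightarrow> bool" where
  "is_struc L M \<longleftrightarrow>
     (\<forall>s. sort_dom M s \<noteq> {} \<longleftrightarrow> s \<in> sorts L) \<and>
     (\<forall>s t. s \<noteq> t \<longrightarrow> sort_dom M s \<inter> sort_dom M t = {}) \<and>
     (\<forall>f\<in>funs L. \<forall>as\<in>tuples M (fun_args L f). fun_int M f as \<in> sort_dom M (fun_sort L f))"

primrec eval_tm :: "('s, 'f, 'r, 'm) struc \<Rightarrow> 'm list \<Rightarrow> 'f tm \<Rightarrow> 'm" where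
  "eval_tm M e (Var n) = e ! n"
| "eval_tm M e (App f ts) = fun_int M f (map (eval_tm M e) ts)"

primrec sat :: "('s, 'f, 'r, 'm) struc \<Rightarrow> 'm list \<Rightarrow> ('s, 'f, 'r) fm \<Rightarrow> bool" where
  "sat M e Bot \<longleftrightarrow> False"
| "sat M e (Eq t u) \<longleftrightarrow> eval_tm M e t = eval_tm M e u"
| "sat M e (Rel r ts) \<longleftrightarrow> rel_int M r (map (eval_tm M e) ts)"
| "sat M e (Neg \<phi>) \<longleftrightarrow> \<not> sat M e \<phi>"
| "sat M e (Conj \<phi> \<psi>) \<longleftrightarrow> sat M e \<phi> \<and> sat M e \<psi>"
| "sat M e (Exists s \<phi>) \<longleftrightarrow> (\<exists>a\<in>sort_dom M s. sat M (a # e) \<phi>)"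

section \<open>Complete theories\<close>

definition is_model ::
  "('s, 'f, 'r) lang \<Rightarrow> ('s, 'f, 'r) fm set \<Rightarrow> ('s, 'f, 'r, 'm) struc \<Rightarrow> bool" where
  "is_model L T M \<longleftrightarrow> is_struc L M \<and> (\<forall>\<sigma>\<in>T. sat M [] \<sigma>)"

text \<open>
  HOL cannot quantify over the universes of all models, so the notions below refer to the
  models whose elements lie in a given type \<^typ>\<open>'m\<close>. They are applied to a type containing
  the elements of a monster model.
\<close>

definition entails ::
  "'m itself \<Rightarrow> ('s, 'f, 'r) lang \<Rightarrow> ('s, 'f, 'r) fm set \<Rightarrow> ('s, 'f, 'r) fm \<Rightarrow> bool" where
  "entails TM L T \<sigma> \<longleftrightarrow> (\<forall>M :: ('s, 'f, 'r, 'm) struc. is_model L T M \<longrightarrow> sat M [] \<sigma>)"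

definition complete_theory ::
  "'m itself \<Rightarrow> ('s, 'f, 'r) lang \<Rightarrow> ('s, 'f, 'r) fm set \<Rightarrow> bool" where
  "complete_theory TM L T \<longleftrightarrow>
     T \<subseteq> sentences L \<and>
     (\<exists>M :: ('s, 'f, 'r, 'm) struc. is_model L T M) \<and>
     (\<forall>\<sigma>\<in>sentences L. entails TM L T \<sigma> \<or> entails TM L T (Neg \<sigma>))"

text \<open>
  The cardinal \<open>|T|\<close> is, by the usual convention, the number of formulas of the language, i.e. the
  cardinality of the language plus \<open>\<aleph>\<^sub>0\<close>. For a deductively closed complete \<open>T\<close> this is also
  the cardinality of \<open>T\<close> as a set; in general \<open>T\<close> may be a smaller set of axioms.
\<close>

definition card_theory :: "('s, 'f, 'r) lang \<Rightarrow> ('s, 'f, 'r) fm rel" where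
  "card_theory L = |\<Union>\<Gamma>. formulas L \<Gamma>|"

section \<open>2-dependence\<close>

definition not_two_dependent_formula ::
  "'m itself \<Rightarrow> ('s, 'f, 'r) lang \<Rightarrow> ('s, 'f, 'r) fm set \<Rightarrow>
   's list \<Rightarrow> 's list \<Rightarrow> 's list \<Rightarrow> ('s, 'f, 'r) fm \<Rightarrow> bool" where
  "not_two_dependent_formula TM L T X Y1 Y2 \<phi> \<longleftrightarrow>
     (\<exists>(M :: ('s, 'f, 'r, 'm) struc) (a1 :: nat \<Rightarrow> 'm list) (a2 :: nat \<Rightarrow> 'm list).
        is_model L T M \<and>
        (\<forall>i. a1 i \<in> tuples M Y1 \<and> a2 i \<in> tuples M Y2) \<and>
        (\<forall>S :: (nat \<times> nat) set. \<exists>e\<in>tuples M X.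
           \<forall>i1 i2. sat M (e @ a1 i1 @ a2 i2) \<phi> \<longleftrightarrow> (i1, i2) \<in> S))"

definition two_dependent ::
  "'m itself \<Rightarrow> ('s, 'f, 'r) lang \<Rightarrow> ('s, 'f, 'r) fm set \<Rightarrow> bool" where
  "two_dependent TM L T \<longleftrightarrow>
     (\<forall>X Y1 Y2. \<forall>\<phi>\<in>formulas L (X @ Y1 @ Y2). \<not> not_two_dependent_formula TM L T X Y1 Y2 \<phi>)"

section \<open>Monster models\<close>

definition strongly_inaccessible :: "'u rel \<Rightarrow> bool" where
  "strongly_inaccessible \<mu> \<longleftrightarrow>
     Card_order \<mu> \<and> natLeq <o \<mu> \<and> regularCard \<mu> \<and>
     (\<forall>A\<subseteq>Field \<mu>. |A| <o \<mu> \<longrightarrow> |Pow A| <o \<mu>)"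

text \<open>
  A formula with parameters is a pair \<open>(\<phi>, q)\<close>, standing for \<open>\<phi>(x, q)\<close>; here \<open>x\<close> is a tuple of
  variables of sorts \<open>X\<close>.
\<close>

definition param_formulas ::
  "('s, 'f, 'r) lang \<Rightarrow> ('s, 'f, 'r, 'm) struc \<Rightarrow> 's list \<Rightarrow> 'm set \<Rightarrow>
   (('s, 'f, 'r) fm \<times> 'm list) set" where
  "param_formulas L M X A =
     {(\<phi>, q). set q \<subseteq> A \<and> (\<exists>Q. q \<in> tuples M Q \<and> \<phi> \<in> formulas L (X @ Q))}"

definition realizes ::
  "('s, 'f, 'r, 'm) struc \<Rightarrow> 'm list \<Rightarrow> (('s, 'f, 'r) fm \<times> 'm list) set \<Rightarrow> bool" where
  "realizes M e p \<longleftrightarrow> (\<forall>(\<phi>, q)\<in>p. sat M (e @ q) \<phi>)"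

definition saturated ::
  "('s, 'f, 'r) lang \<Rightarrow> 'u rel \<Rightarrow> ('s, 'f, 'r, 'm) struc \<Rightarrow> bool" where
  "saturated L \<mu> M \<longleftrightarrow>
     (\<forall>A X p. A \<subseteq> elems M \<and> |A| <o \<mu> \<and> p \<subseteq> param_formulas L M X A \<and>
        (\<forall>p0\<subseteq>p. finite p0 \<longrightarrow> (\<exists>e\<in>tuples M X. realizes M e p0)) \<longrightarrow>
        (\<exists>e\<in>tuples M X. realizes M e p))"

definition elementary_map ::
  "('s, 'f, 'r) lang \<Rightarrow> ('s, 'f, 'r, 'm) struc \<Rightarrow> 'm set \<Rightarrow> ('m \<Rightarrow> 'm) \<Rightarrow> bool" where
  "elementary_map L M A h \<longleftrightarrow>
     (\<forall>q Q. set q \<subseteq> A \<and> q \<in> tuples M Q \<longrightarrow>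
        map h q \<in> tuples M Q \<and> (\<forall>\<phi>\<in>formulas L Q. sat M q \<phi> \<longleftrightarrow> sat M (map h q) \<phi>))"

definition automorphism ::
  "('s, 'f, 'r) lang \<Rightarrow> ('s, 'f, 'r, 'm) struc \<Rightarrow> ('m \<Rightarrow> 'm) \<Rightarrow> bool" where
  "automorphism L M g \<longleftrightarrow>
     (\<forall>s\<in>sorts L. bij_betw g (sort_dom M s) (sort_dom M s)) \<and>
     (\<forall>f\<in>funs L. \<forall>as\<in>tuples M (fun_args L f). g (fun_int M f as) = fun_int M f (map g as)) \<and>
     (\<forall>r\<in>rels L. \<forall>as\<in>tuples M (rel_args L r). rel_int M r as \<longleftrightarrow> rel_int M r (map g as))"

text \<open>As usual for monster models, homogeneity is meant in the strong sense.\<close>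

definition homogeneous ::
  "('s, 'f, 'r) lang \<Rightarrow> 'u rel \<Rightarrow> ('s, 'f, 'r, 'm) struc \<Rightarrow> bool" where
  "homogeneous L \<mu> M \<longleftrightarrow>
     (\<forall>A h. A \<subseteq> elems M \<and> |A| <o \<mu> \<and> elementary_map L M A h \<longrightarrow>
        (\<exists>g. automorphism L M g \<and> (\<forall>a\<in>A. g a = h a)))"

definition monster ::
  "('s, 'f, 'r) lang \<Rightarrow> ('s, 'f, 'r) fm set \<Rightarrow> 'u rel \<Rightarrow> ('s, 'f, 'r, 'm) struc \<Rightarrow> bool" where
  "monster L T \<mu> M \<longleftrightarrow>
     is_model L T M \<and> strongly_inaccessible \<mu> \<and> saturated L \<mu> M \<and> homogeneous L \<mu> M"

section \<open>Types and indiscernible sequences\<close>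

text \<open>A set of tuples serves as a set of parameters through the coordinates of its tuples.\<close>

definition coords :: "'m list set \<Rightarrow> 'm set" where
  "coords A = (\<Union>a\<in>A. set a)"

definition tp ::
  "('s, 'f, 'r) lang \<Rightarrow> ('s, 'f, 'r, 'm) struc \<Rightarrow> 's list \<Rightarrow> 'm list \<Rightarrow> 'm list set \<Rightarrow>
   (('s, 'f, 'r) fm \<times> 'm list) set" where
  "tp L M X b A = {(\<phi>, q) \<in> param_formulas L M X (coords A). sat M (b @ q) \<phi>}"

definition realized_types ::
  "('s, 'f, 'r) lang \<Rightarrow> ('s, 'f, 'r, 'm) struc \<Rightarrow> 's list \<Rightarrow> 'm list set \<Rightarrow> 'm list set \<Rightarrow>
   (('s, 'f, 'r) fm \<times> 'm list) set set" where
  "realized_types L M X B A = (\<lambda>b. tp L M X b A) ` B"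

definition strictly_less :: "'i rel \<Rightarrow> 'i \<Rightarrow> 'i \<Rightarrow> bool" where
  "strictly_less r i j \<longleftrightarrow> (i, j) \<in> r \<and> i \<noteq> j"

definition increasing :: "'i rel \<Rightarrow> 'i list \<Rightarrow> bool" where
  "increasing r is \<longleftrightarrow> set is \<subseteq> Field r \<and> sorted_wrt (strictly_less r) is"

text \<open>
  A sequence \<open>(a\<^sub>i : i \<in> r)\<close> indexed by an order \<open>r\<close> is a function on \<open>Field r\<close>; its terms are
  tuples of the same sorts \<open>X\<close>.
\<close>

definition indiscernible_over ::
  "('s, 'f, 'r) lang \<Rightarrow> ('s, 'f, 'r, 'm) struc \<Rightarrow> 's list \<Rightarrow> 'i rel \<Rightarrow> ('i \<Rightarrow> 'm list) \<Rightarrow>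
   'm set \<Rightarrow> bool" where
  "indiscernible_over L M X r a A \<longleftrightarrow>
     (\<forall>is js. increasing r is \<and> increasing r js \<and> length is = length js \<longrightarrow>
        (\<forall>(\<phi>, q)\<in>param_formulas L M (concat (replicate (length is) X)) A.
           sat M (concat (map a is) @ q) \<phi> \<longleftrightarrow> sat M (concat (map a js) @ q) \<phi>))"

definition mutually_indiscernible ::
  "('s, 'f, 'r) lang \<Rightarrow> ('s, 'f, 'r, 'm) struc \<Rightarrow>
   's list \<Rightarrow> 'i rel \<Rightarrow> ('i \<Rightarrow> 'm list) \<Rightarrow> 's list \<Rightarrow> 'j rel \<Rightarrow> ('j \<Rightarrow> 'm list) \<Rightarrow> bool" where
  "mutually_indiscernible L M X r a Y r' b \<longleftrightarrow>
     indiscernible_over L M X r a (coords (b ` Field r')) \<and>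
     indiscernible_over L M Y r' b (coords (a ` Field r))"

section \<open>Dedekind cuts\<close>

text \<open>
  A cut is identified with its lower part. The two improper cuts are included, and the lower part
  may have a maximum; since \<open>ded \<kappa> > \<kappa>\<close> for infinite \<open>\<kappa>\<close>, this does not affect \<open>ded \<kappa>\<close>.
\<close>

definition cuts :: "'k set \<Rightarrow> 'k rel \<Rightarrow> 'k set set" where
  "cuts A R = {C. C \<subseteq> A \<and> (\<forall>x\<in>C. \<forall>y. (y, x) \<in> R \<longrightarrow> y \<in> C)}"

text \<open>
  Up to isomorphism, the linear orders of cardinality \<open>\<kappa>\<close> are the linear orders on \<open>Field \<kappa>\<close>.
  Each of them has at most \<open>2\<^sup>\<kappa>\<close> cuts, so the supremum exists among the cardinals on sets
  of subsets; it is unique up to \<open>=o\<close>.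
\<close>

definition is_ded :: "'k rel \<Rightarrow> 'k set rel \<Rightarrow> bool" where
  "is_ded \<kappa> \<delta> \<longleftrightarrow>
     Card_order \<delta> \<and>
     (\<forall>R. linear_order_on (Field \<kappa>) R \<longrightarrow> |cuts (Field \<kappa>) R| \<le>o \<delta>) \<and>
     (\<forall>\<delta>'::'k set rel. Card_order \<delta>' \<and>
        (\<forall>R. linear_order_on (Field \<kappa>) R \<longrightarrow> |cuts (Field \<kappa>) R| \<le>o \<delta>') \<longrightarrow> \<delta> \<le>o \<delta>')"

definition ded :: "'k rel \<Rightarrow> 'k set rel" where
  "ded \<kappa> = (SOME \<delta>. is_ded \<kappa> \<delta>)"

lemma is_ded_ded: "is_ded \<kappa> (ded \<kappa>)"
proof -
  let ?U = "{\<delta> :: 'a set rel. Card_order \<delta> \<and>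
    (\<forall>R. linear_order_on (Field \<kappa>) R \<longrightarrow> |cuts (Field \<kappa>) R| \<le>o \<delta>)}"
  have "|UNIV :: 'a set set| \<in> ?U"
    by (auto simp: card_of_Card_order intro: card_of_mono1)
  then have "\<exists>\<delta>\<in>?U. \<forall>\<delta>'\<in>?U. \<delta> \<le>o \<delta>'"
    by (intro exists_minim_Card_order) auto
  then have "\<exists>\<delta>. is_ded \<kappa> \<delta>"
    unfolding is_ded_def by blast
  then show ?thesis
    unfolding ded_def by (rule someI_ex)
qed

end

theory Submission
  imports Defs
begin

text \<open>
  A type over \<open>I \<times> {c}\<close> is determined by the traces \<open>{t \<in> \<kappa>\<^sup>p : \<phi>(c, a\<^sub>t, b)}\<close>, one for each formula
  \<open>\<phi>(z; x\<^sub>1, \<dots>, x\<^sub>p; y)\<close>. There are \<open>|T|\<close> many \<open>\<phi>\<close> and \<open>|T| < \<lambda>\<close> with \<open>\<lambda>\<close> regular, so it is enough to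
  find for each \<open>\<phi>\<close> some \<open>\<beta>\<close> for which \<open>J\<^sub>>\<^sub>\<beta>\<close> has at most \<open>ded \<kappa>\<close> traces. Suppose that there is none.
  By a theorem of Shelah, a family of more than \<open>ded \<kappa>\<close> subsets of a set of size \<open>\<kappa>\<close> shatters
  finite sets of every size. As there are only \<open>\<kappa> < \<lambda>\<close> finite sets, for each \<open>n\<close> one and the same set of
  size \<open>n\<close> is shattered by \<open>J\<^sub>>\<^sub>\<beta>\<close> for all \<open>\<beta>\<close>, and so every finite bipartite pattern appears between it and
  some increasing sequence from \<open>J\<close>. Since \<open>J\<close> is indiscernible over \<open>I\<close>, the increasing sequence can be
  fixed, provided that \<open>c\<close> is allowed to vary with the pattern. By saturation \<open>\<phi>\<close> is not 2-dependent.
\<close>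

section \<open>Picking variables\<close>

lemma length_tuples: "as \<in> tuples M X \<Longrightarrow> length as = length X"
  by (auto simp: tuples_def dest: list_all2_lengthD)

lemma tuples_append: "as \<in> tuples M X \<Longrightarrow> bs \<in> tuples M Y \<Longrightarrow> as @ bs \<in> tuples M (X @ Y)"
  by (auto simp: tuples_def intro: list_all2_appendI)

lemma tuples_Cons_iff: "as \<in> tuples M (s # X) \<longleftrightarrow> (\<exists>a\<in>sort_dom M s. \<exists>bs\<in>tuples M X. as = a # bs)"
  by (auto simp: tuples_def list_all2_Cons2)

lemma tuples_Nil [simp]: "tuples M [] = {[]}"
  by (auto simp: tuples_def)

lemma tuples_concat:
  "list_all2 (\<lambda>as X. as \<in> tuples M X) bs Xs \<Longrightarrow> concat bs \<in> tuples M (concat Xs)"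
  by (induction rule: list_all2_induct) (auto intro: tuples_append)

lemma tuples_sorts: "is_struc L M \<Longrightarrow> as \<in> tuples M X \<Longrightarrow> set X \<subseteq> sorts L"
  by (fastforce simp: tuples_def is_struc_def list_all2_conv_all_nth in_set_conv_nth)

lemma tuples_elems: "as \<in> tuples M X \<Longrightarrow> set as \<subseteq> elems M"
  by (fastforce simp: tuples_def elems_def list_all2_conv_all_nth in_set_conv_nth)

section \<open>Renaming of variables, conjunction and quantification of formulas\<close>

primrec ren_tm :: "(nat \<Rightarrow> nat) \<Rightarrow> 'f tm \<Rightarrow> 'f tm" where
  "ren_tm \<sigma> (Var n) = Var (\<sigma> n)"
| "ren_tm \<sigma> (App f ts) = App f (map (ren_tm \<sigma>) ts)"

text \<open>Under a quantifier index 0 is bound and must stay fixed, while \<open>\<sigma>\<close>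
  acts on the free indices, all of which are shifted by one.\<close>

primrec ren :: "(nat \<Rightarrow> nat) \<Rightarrow> ('s, 'f, 'r) fm \<Rightarrow> ('s, 'f, 'r) fm" where
  "ren \<sigma> Bot = Bot"
| "ren \<sigma> (Eq t u) = Eq (ren_tm \<sigma> t) (ren_tm \<sigma> u)"
| "ren \<sigma> (Rel r ts) = Rel r (map (ren_tm \<sigma>) ts)"
| "ren \<sigma> (Neg \<phi>) = Neg (ren \<sigma> \<phi>)"
| "ren \<sigma> (Conj \<phi> \<psi>) = Conj (ren \<sigma> \<phi>) (ren \<sigma> \<psi>)"
| "ren \<sigma> (Exists s \<phi>) = Exists s (ren (case_nat 0 (\<lambda>n. Suc (\<sigma> n))) \<phi>)"

lemma has_sort_ren_tm:
  assumes "has_sort L \<Delta> t s" and "\<And>n. n < length \<Delta> \<Longrightarrow> \<sigma> n < length \<Gamma> \<and> \<Gamma> ! \<sigma> n = \<Delta> ! n"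
  shows "has_sort L \<Gamma> (ren_tm \<sigma> t) s"
  using assms(1)
proof (induction rule: has_sort.induct)
  case (1 n)
  then show ?case
    using assms(2)[of n] has_sort.intros(1)[of "\<sigma> n" \<Gamma> L] by auto
next
  case (2 f ts)
  then have "list_all2 (has_sort L \<Gamma>) (map (ren_tm \<sigma>) ts) (fun_args L f)"
    by (auto simp: list_all2_map1 elim: list_all2_mono)
  then show ?case
    using 2 by (auto intro: has_sort.intros(2))
qed

lemma well_sorted_ren:
  assumes "well_sorted L \<Delta> \<phi>" and "\<And>n. n < length \<Delta> \<Longrightarrow> \<sigma> n < length \<Gamma> \<and> \<Gamma> ! \<sigma> n = \<Delta> ! n"
  shows "well_sorted L \<Gamma> (ren \<sigma> \<phi>)"
  using assms
proof (induction \<phi> arbitrary: \<Gamma> \<Delta> \<sigma>)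
  case (Eq t u)
  then show ?case by (auto intro: has_sort_ren_tm)
next
  case (Rel r ts)
  then show ?case
    by (auto simp: list_all2_map1 elim!: list_all2_mono intro: has_sort_ren_tm)
next
  case (Exists s \<phi>)
  show ?case
    using Exists.prems by (auto intro!: Exists.IH[of "s # \<Delta>"] split: nat.split)
qed auto

lemma eval_tm_ren_tm:
  assumes "has_sort L \<Delta> t s" and "\<And>n. n < length \<Delta> \<Longrightarrow> e ! \<sigma> n = e' ! n"
  shows "eval_tm M e (ren_tm \<sigma> t) = eval_tm M e' t"
  using assms(1)
proof (induction rule: has_sort.induct)
  case (1 n)
  then show ?case using assms(2) by simp
next
  case (2 f ts)
  then have "map (eval_tm M e) (map (ren_tm \<sigma>) ts) = map (eval_tm M e') ts"
    unfolding map_map by (intro nth_equalityI) (auto simp: list_all2_conv_all_nth)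
  then show ?case by (simp del: map_map map_eq_conv)
qed

lemma sat_ren:
  assumes "well_sorted L \<Delta> \<phi>" and "\<And>n. n < length \<Delta> \<Longrightarrow> e ! \<sigma> n = e' ! n"
  shows "sat M e (ren \<sigma> \<phi>) \<longleftrightarrow> sat M e' \<phi>"
  using assms
proof (induction \<phi> arbitrary: \<Delta> \<sigma> e e')
  case (Eq t u)
  then show ?case by (auto simp: eval_tm_ren_tm)
next
  case (Rel r ts)
  then have "map (eval_tm M e) (map (ren_tm \<sigma>) ts) = map (eval_tm M e') ts"
    unfolding map_map
    by (intro nth_equalityI) (auto simp: list_all2_conv_all_nth intro!: eval_tm_ren_tm)
  then show ?case by (simp del: map_map map_eq_conv)
next
  case (Exists s \<phi>)
  have "sat M (a # e) (ren (case_nat 0 (\<lambda>n. Suc (\<sigma> n))) \<phi>) \<longleftrightarrow> sat M (a # e') \<phi>" for a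
    using Exists.prems by (intro Exists.IH[of "s # \<Delta>"]) (auto split: nat.split)
  then show ?case by simp
next
  case (Conj \<phi> \<psi>)
  have "sat M e (ren \<sigma> \<phi>) \<longleftrightarrow> sat M e' \<phi>" "sat M e (ren \<sigma> \<psi>) \<longleftrightarrow> sat M e' \<psi>"
    using Conj.prems by (auto intro!: Conj.IH[of \<Delta>])
  then show ?case by simp
qed auto

text \<open>\<open>ns\<close> says where in \<open>\<Gamma>\<close> each variable of
  \<open>\<phi>\<close> is to be read. Positions may repeat or be missing, so permuting and
  identifying variables and adding dummy ones are all instances.\<close>

lemma pick_variables:
  assumes "\<phi> \<in> formulas L \<Delta>" and "set \<Gamma> \<subseteq> sorts L"
    and "list_all2 (\<lambda>i s. i < length \<Gamma> \<and> \<Gamma> ! i = s) ns \<Delta>"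
  obtains \<psi> where "\<psi> \<in> formulas L \<Gamma>" and "\<And>e. sat M e \<psi> \<longleftrightarrow> sat M (map ((!) e) ns) \<phi>"
proof
  have l: "n < length \<Delta> \<Longrightarrow> ns ! n < length \<Gamma> \<and> \<Gamma> ! (ns ! n) = \<Delta> ! n \<and> n < length ns" for n
    using assms(3) by (auto simp: list_all2_conv_all_nth)
  show "ren ((!) ns) \<phi> \<in> formulas L \<Gamma>"
    using assms l by (auto simp: formulas_def intro: well_sorted_ren)
  show "sat M e (ren ((!) ns) \<phi>) \<longleftrightarrow> sat M (map ((!) e) ns) \<phi>" for e
    using assms l by (intro sat_ren[where L=L and \<Delta>=\<Delta>]) (auto simp: formulas_def)
qed

lemma finite_conjunction:
  assumes "finite A" and "set \<Gamma> \<subseteq> sorts L"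
    and "\<And>x. x \<in> A \<Longrightarrow> \<exists>\<phi>\<in>formulas L \<Gamma>. \<forall>e. sat M e \<phi> \<longleftrightarrow> P x e"
  shows "\<exists>\<phi>\<in>formulas L \<Gamma>. \<forall>e. sat M e \<phi> \<longleftrightarrow> (\<forall>x\<in>A. P x e)"
  using assms(1,3)
proof (induction A)
  case empty
  show ?case
    using assms(2) by (intro bexI[of _ "Neg Bot"]) (auto simp: formulas_def)
next
  case (insert x A)
  have "\<exists>\<psi>\<in>formulas L \<Gamma>. \<forall>e. sat M e \<psi> \<longleftrightarrow> (\<forall>x\<in>A. P x e)"
    using insert.IH insert.prems by simp
  moreover have "\<exists>\<phi>\<in>formulas L \<Gamma>. \<forall>e. sat M e \<phi> \<longleftrightarrow> P x e"
    using insert.prems by simp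
  ultimately obtain \<phi> \<psi> where "\<phi> \<in> formulas L \<Gamma>" "\<forall>e. sat M e \<phi> \<longleftrightarrow> P x e"
    "\<psi> \<in> formulas L \<Gamma>" "\<forall>e. sat M e \<psi> \<longleftrightarrow> (\<forall>x\<in>A. P x e)"
    by blast
  then show ?case
    by (intro bexI[of _ "Conj \<phi> \<psi>"]) (auto simp: formulas_def)
qed

text \<open>A quantifier always binds the front of the context, so the bound tuple must come first.
  Its first variable gets the innermost quantifier, which leaves a shorter tuple in front.\<close>

lemma exists_tuple:
  assumes "\<phi> \<in> formulas L (X @ \<Gamma>)"
  shows "\<exists>\<psi>\<in>formulas L \<Gamma>. \<forall>e. sat M e \<psi> \<longleftrightarrow> (\<exists>z\<in>tuples M X. sat M (z @ e) \<phi>)"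
  using assms
proof (induction X arbitrary: \<phi>)
  case Nil
  then show ?case by auto
next
  case (Cons s X)
  then have "Exists s \<phi> \<in> formulas L (X @ \<Gamma>)"
    by (auto simp: formulas_def)
  from Cons.IH[OF this] obtain \<psi> where "\<psi> \<in> formulas L \<Gamma>"
    "\<forall>e. sat M e \<psi> \<longleftrightarrow> (\<exists>z\<in>tuples M X. sat M (z @ e) (Exists s \<phi>))" by blast
  then show ?case
    by (intro bexI[of _ \<psi>]) (force simp: tuples_Cons_iff)+
qed

section \<open>Coordinates of concatenated blocks\<close>

lemma nth_concat_block:
  assumes "k < length bs" and "u < length (bs ! k)"
  shows "length (concat (take k bs)) + u < length (concat bs)"
    and "concat bs ! (length (concat (take k bs)) + u) = bs ! k ! u"
proof -
  have "concat bs = concat (take k bs) @ bs ! k @ concat (drop (Suc k) bs)"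
    using assms by (metis concat.simps(2) concat_append id_take_nth_drop)
  then obtain cs where "concat bs = concat (take k bs) @ bs ! k @ cs"
    by blast
  then show "length (concat (take k bs)) + u < length (concat bs)"
    "concat bs ! (length (concat (take k bs)) + u) = bs ! k ! u"
    using assms by (simp_all add: nth_append)
qed

text \<open>A pair \<open>(k, u)\<close> addresses entry \<open>u\<close> of block \<open>k\<close>.
  The offsets of the blocks depend on the sorts alone, so one formula serves all tuples of these
  sorts.\<close>

lemma pick_coordinates:
  assumes "\<phi> \<in> formulas L \<Delta>" and "set (concat Xs) \<subseteq> sorts L"
    and "list_all2 (\<lambda>(k, u) s. k < length Xs \<and> u < length (Xs ! k) \<and> Xs ! k ! u = s) kus \<Delta>"
  shows "\<exists>\<psi>\<in>formulas L (concat Xs). \<forall>bs. list_all2 (\<lambda>as X. as \<in> tuples M X) bs Xs \<longrightarrow>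
    sat M (concat bs) \<psi> \<longleftrightarrow> sat M (map (\<lambda>(k, u). bs ! k ! u) kus) \<phi>"
proof -
  define off where "off k = length (concat (take k Xs))" for k
  define ns where "ns = map (\<lambda>(k, u). off k + u) kus"
  have "list_all2 (\<lambda>i s. i < length (concat Xs) \<and> concat Xs ! i = s) ns \<Delta>"
    unfolding ns_def list_all2_map1 using assms(3)
    by (rule list_all2_mono) (auto simp: off_def nth_concat_block)
  then obtain \<psi> where \<psi>: "\<psi> \<in> formulas L (concat Xs)" "\<And>e. sat M e \<psi> \<longleftrightarrow> sat M (map ((!) e) ns) \<phi>"
    using pick_variables[OF assms(1,2), of ns M] by metis
  have "map ((!) (concat bs)) ns = map (\<lambda>(k, u). bs ! k ! u) kus"
    if bs: "list_all2 (\<lambda>as X. as \<in> tuples M X) bs Xs" for bs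
  proof -
    have len: "length bs = length Xs" "\<And>k. k < length Xs \<Longrightarrow> length (bs ! k) = length (Xs ! k)"
      using bs by (auto simp: list_all2_conv_all_nth length_tuples)
    then have "map length (take k bs) = map length (take k Xs)" for k
      by (auto intro!: nth_equalityI)
    then have off: "off k = length (concat (take k bs))" for k
      by (simp add: off_def length_concat)
    have "fst ku < length bs \<and> snd ku < length (bs ! fst ku)" if "ku \<in> set kus" for ku
      using that assms(3) by (auto simp: list_all2_conv_all_nth in_set_conv_nth split_beta len)
    then show ?thesis
      by (auto simp: ns_def off nth_concat_block)
  qed
  with \<psi> show ?thesis by (intro bexI[of _ \<psi>]) auto
qed

text \<open>Each index in \<open>ks\<close> is expanded into the list of all coordinates of its
  block.\<close>

lemma pick_blocks:
  assumes "\<phi> \<in> formulas L (concat (map ((!) Xs) ks))" and "set (concat Xs) \<subseteq> sorts L"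
    and "set ks \<subseteq> {..<length Xs}"
  shows "\<exists>\<psi>\<in>formulas L (concat Xs). \<forall>bs. list_all2 (\<lambda>as X. as \<in> tuples M X) bs Xs \<longrightarrow>
    sat M (concat bs) \<psi> \<longleftrightarrow> sat M (concat (map ((!) bs) ks)) \<phi>"
proof -
  define kus where "kus = concat (map (\<lambda>k. map (Pair k) [0..<length (Xs ! k)]) ks)"
  have "list_all2 (\<lambda>(k, u) s. k < length Xs \<and> u < length (Xs ! k) \<and> Xs ! k ! u = s)
      kus (concat (map ((!) Xs) ks))"
    using assms(3) unfolding kus_def
  proof (induction ks)
    case (Cons k ks)
    moreover have "list_all2 (\<lambda>(k, u) s. k < length Xs \<and> u < length (Xs ! k) \<and> Xs ! k ! u = s)
        (map (Pair k) [0..<length (Xs ! k)]) (Xs ! k)"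
      using Cons.prems by (auto simp: list_all2_conv_all_nth)
    ultimately show ?case
      by (auto intro: list_all2_appendI)
  qed simp
  from pick_coordinates[OF assms(1,2) this, of M] obtain \<psi> where \<psi>: "\<psi> \<in> formulas L (concat Xs)"
    "\<And>bs. list_all2 (\<lambda>as X. as \<in> tuples M X) bs Xs \<Longrightarrow>
      sat M (concat bs) \<psi> \<longleftrightarrow> sat M (map (\<lambda>(k, u). bs ! k ! u) kus) \<phi>"
    by blast
  have "map (\<lambda>(k, u). bs ! k ! u) kus = concat (map ((!) bs) ks)"
    if bs: "list_all2 (\<lambda>as X. as \<in> tuples M X) bs Xs" for bs
  proof -
    have "map (\<lambda>u. bs ! k ! u) [0..<length (Xs ! k)] = bs ! k" if "k \<in> set ks" for k
    proof -
      have "length (bs ! k) = length (Xs ! k)"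
        using that bs assms(3) by (intro length_tuples[of _ M]) (auto simp: list_all2_conv_all_nth)
      then show ?thesis by (metis map_nth)
    qed
    then show ?thesis
      unfolding kus_def by (auto simp: map_concat o_def intro!: arg_cong[of _ _ concat])
  qed
  with \<psi> show ?thesis by (intro bexI[of _ \<psi>]) auto
qed

section \<open>Large families of sets shatter large finite sets\<close>

definition lex_le :: "'a rel \<Rightarrow> 'a set \<Rightarrow> 'a set \<Rightarrow> bool" where
  "lex_le r A B \<longleftrightarrow> A = B \<or> (\<exists>i\<in>B - A. A \<inter> underS r i = B \<inter> underS r i)"

lemma least_difference:
  assumes "Well_order r" and "A \<subseteq> Field r" and "B \<subseteq> Field r" and "A \<noteq> B"
  obtains i where "i \<in> Field r" and "i \<in> A \<longleftrightarrow> i \<notin> B" and "A \<inter> underS r i = B \<inter> underS r i"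
proof -
  have wo: "wo_rel r" using assms(1) by (simp add: wo_rel_def)
  let ?D = "{x. x \<in> A \<longleftrightarrow> x \<notin> B}"
  have "?D \<subseteq> Field r" "?D \<noteq> {}" using assms by auto
  then obtain i where i: "i \<in> ?D" "\<forall>x\<in>?D. (i, x) \<in> r"
    using wo_rel.Well_order_isMinim_exists[OF wo, of ?D] by (auto simp: wo_rel.isMinim_def[OF wo])
  have "x \<notin> ?D" if "x \<in> underS r i" for x
    using that i(2) wo_rel.ANTISYM[OF wo] by (auto simp: underS_def dest: antisymD)
  then show thesis
    using i(1) \<open>?D \<subseteq> Field r\<close> by (intro that[of i]) auto
qed

lemma lex_le_total:
  assumes "Well_order r" and "A \<subseteq> Field r" and "B \<subseteq> Field r"
  shows "lex_le r A B \<or> lex_le r B A"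
proof (cases "A = B")
  case False
  then show ?thesis
    using least_difference[OF assms] unfolding lex_le_def by (metis DiffI)
qed (simp add: lex_le_def)

lemma Well_order_cases:
  assumes "Well_order r" and "i \<in> Field r" and "j \<in> Field r"
  obtains "i = j" | "i \<in> underS r j" | "j \<in> underS r i"
  using wo_rel.TOTALS[of r] assms by (auto simp: wo_rel_def underS_def)

lemma underS_subset:
  assumes "Well_order r" and "i \<in> underS r j"
  shows "underS r i \<subseteq> underS r j"
proof -
  have "wo_rel r" using assms(1) by (simp add: wo_rel_def)
  then have "trans r" "antisym r"
    by (simp_all add: wo_rel.TRANS wo_rel.ANTISYM)
  then show ?thesis
    using assms(2) by (auto simp: underS_def dest: transD antisymD)
qed

lemma lex_le_antisym:
  assumes "Well_order r" and "A \<subseteq> Field r" and "B \<subseteq> Field r"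
    and "lex_le r A B" and "lex_le r B A"
  shows "A = B"
proof (rule ccontr)
  assume "A \<noteq> B"
  then obtain i j where ij: "i \<in> B - A" "A \<inter> underS r i = B \<inter> underS r i"
    "j \<in> A - B" "A \<inter> underS r j = B \<inter> underS r j"
    using assms(4,5) unfolding lex_le_def by metis
  then have "i \<in> Field r" "j \<in> Field r" using assms by auto
  then show False
    by (rule Well_order_cases[OF assms(1)]) (use ij in blast)+
qed

lemma lex_le_trans:
  assumes "Well_order r" and "A \<subseteq> Field r" and "B \<subseteq> Field r" and "C \<subseteq> Field r"
    and "lex_le r A B" and "lex_le r B C"
  shows "lex_le r A C"
proof (cases "A = B \<or> B = C")
  case False
  then obtain i j where ij: "i \<in> B - A" "A \<inter> underS r i = B \<inter> underS r i"
    "j \<in> C - B" "B \<inter> underS r j = C \<inter> underS r j"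
    using assms(5,6) unfolding lex_le_def by metis
  then have "i \<in> Field r" "j \<in> Field r" using assms by auto
  then show ?thesis
  proof (rule Well_order_cases[OF assms(1)])
    assume *: "i \<in> underS r j"
    then have "i \<in> C - A" "A \<inter> underS r i = C \<inter> underS r i"
      using ij underS_subset[OF assms(1) *] by blast+
    then show ?thesis unfolding lex_le_def by blast
  next
    assume *: "j \<in> underS r i"
    then have "j \<in> C - A" "A \<inter> underS r j = C \<inter> underS r j"
      using ij underS_subset[OF assms(1) *] by blast+
    then show ?thesis unfolding lex_le_def by blast
  qed (use ij in blast)
qed (use assms in auto)

text \<open>At the first difference of two nested sets, only the larger one can contain the
  point.\<close>

lemma lex_le_subset:
  assumes "Well_order r" and "A \<subseteq> B" and "B \<subseteq> Field r"
  shows "lex_le r A B"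
proof (cases "A = B")
  case False
  have "A \<subseteq> Field r" using assms by auto
  from least_difference[OF assms(1) this assms(3) False] obtain i where
    "i \<in> A \<longleftrightarrow> i \<notin> B" "A \<inter> underS r i = B \<inter> underS r i" by blast
  then show ?thesis
    using assms(2) unfolding lex_le_def by blast
qed (simp add: lex_le_def)

section \<open>Cuts, and nodes of the binary tree that are shared by many sets\<close>

lemma card_of_image_factor:
  assumes "\<And>x y. x \<in> A \<Longrightarrow> y \<in> A \<Longrightarrow> g x = g y \<Longrightarrow> f x = f y"
  shows "|f ` A| \<le>o |g ` A|"
proof (rule card_of_ordLeqI)
  \<comment> \<open>\<open>?s\<close> picks a preimage under \<open>f\<close>; two picks with the
    same value under \<open>g\<close> have the same value under \<open>f\<close>.\<close>
  let ?s = "\<lambda>y. SOME x. x \<in> A \<and> f x = y"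
  have s: "?s y \<in> A \<and> f (?s y) = y" if "y \<in> f ` A" for y
    by (rule someI_ex) (use that in auto)
  then show "y \<in> f ` A \<Longrightarrow> g (?s y) \<in> g ` A" for y by blast
  show "inj_on (\<lambda>y. g (?s y)) (f ` A)"
  proof (rule inj_onI)
    fix y z assume y: "y \<in> f ` A" and z: "z \<in> f ` A" and "g (?s y) = g (?s z)"
    then have "f (?s y) = f (?s z)"
      using s[OF y] s[OF z] by (intro assms) auto
    then show "y = z"
      using s[OF y] s[OF z] by simp
  qed
qed

text \<open>The well-order \<open>\<kappa>\<close> is itself one of the linear orders, and its
  initial segments \<open>underS\<close> are \<open>\<kappa>\<close> many different cuts.\<close>

lemma ordLeq_ded:
  assumes "Card_order \<kappa>"
    and "\<And>R. linear_order_on (Field \<kappa>) R \<Longrightarrow> |cuts (Field \<kappa>) R| \<le>o \<delta>"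
  shows "\<kappa> \<le>o \<delta>"
proof -
  have wo: "Well_order \<kappa>" using assms(1) by (rule Card_order_wo_rel[unfolded wo_rel_def])
  have "inj_on (underS \<kappa>) (Field \<kappa>)"
  proof (rule inj_onI)
    fix i j assume "i \<in> Field \<kappa>" "j \<in> Field \<kappa>" and eq: "underS \<kappa> i = underS \<kappa> j"
    then show "i = j"
      by (rule_tac Well_order_cases[OF wo, of i j]) (auto simp: underS_def)
  qed
  moreover have "underS \<kappa> i \<in> cuts (Field \<kappa>) \<kappa>" for i
    using underS_subset[OF wo] wo
    by (auto simp: cuts_def underS_def Field_def well_order_on_def linear_order_on_def
        partial_order_on_def preorder_on_def dest: transD antisymD)
  ultimately have "|Field \<kappa>| \<le>o |cuts (Field \<kappa>) \<kappa>|"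
    by (intro card_of_ordLeqI)
  also have "|cuts (Field \<kappa>) \<kappa>| \<le>o \<delta>"
    using wo by (intro assms(2)) (auto simp: well_order_on_def)
  finally show ?thesis
    using card_of_Field_ordIso[OF assms(1)] ordIso_ordLeq_trans ordIso_symmetric by blast
qed

text \<open>The sets in \<open>F\<close> are seen as branches of the binary tree along
  \<open>r\<close>: restricted to \<open>underS r i\<close>, such a set is a node of level
  \<open>i\<close>.\<close>

definition branch :: "'a rel \<Rightarrow> 'a set set \<Rightarrow> 'a \<Rightarrow> 'a set \<Rightarrow> 'a set set" where
  "branch r F i \<eta> = {f \<in> F. f \<inter> underS r i = \<eta>}"

definition large_nodes :: "'a rel \<Rightarrow> 'd rel \<Rightarrow> 'a set set \<Rightarrow> 'a \<Rightarrow> 'a set set" where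
  "large_nodes r \<delta> F i = {\<eta>. \<not> |branch r F i \<eta>| \<le>o \<delta>}"

lemma large_nodes_subset:
  assumes "\<eta> \<in> large_nodes r \<delta> F i" and "Card_order \<delta>"
  shows "\<exists>f\<in>F. \<eta> = f \<inter> underS r i"
proof (rule ccontr)
  assume "\<not> ?thesis"
  then have "branch r F i \<eta> = {}" by (auto simp: branch_def)
  then show False
    using assms by (auto simp: large_nodes_def card_of_empty3 card_of_empty1)
qed

text \<open>
  Two sets whose first difference \<open>i\<close> lies at a large node \<open>\<eta>\<close> are separated in the lexicographic
  order by \<open>insert i \<eta>\<close>, hence they induce different cuts in the set of these separators.
\<close>

lemma few_large_nodes:
  assumes \<kappa>: "Card_order \<kappa>" "infinite (Field \<kappa>)" and \<delta>: "Card_order \<delta>"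
    and ded: "\<And>R. linear_order_on (Field \<kappa>) R \<Longrightarrow> |cuts (Field \<kappa>) R| \<le>o \<delta>"
    and F: "F \<subseteq> Pow (Field \<kappa>)"
    and few: "|SIGMA i : Field \<kappa>. large_nodes \<kappa> \<delta> F i| \<le>o \<kappa>"
  shows "|F| \<le>o \<delta>"
proof -
  have wo: "Well_order \<kappa>" using \<kappa>(1) by (rule Card_order_wo_rel[unfolded wo_rel_def])
  have \<kappa>\<delta>: "\<kappa> \<le>o \<delta>" by (rule ordLeq_ded[OF \<kappa>(1) ded])
  then have \<delta>inf: "infinite (Field \<delta>)"
    using \<kappa>(2) card_of_mono2 card_of_ordLeq_infinite by blast
  let ?N = "SIGMA i : Field \<kappa>. large_nodes \<kappa> \<delta> F i"
  define D where "D = (\<lambda>(i, \<eta>). insert i \<eta>) ` ?N"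
  have D: "D \<subseteq> Pow (Field \<kappa>)"
    using large_nodes_subset[OF _ \<delta>] F by (fastforce simp: D_def)
  have "|D| \<le>o |Field \<kappa>|"
    using few card_of_image[of _ ?N] card_of_Field_ordIso[OF \<kappa>(1)] unfolding D_def
    by (meson ordLeq_transitive ordLeq_ordIso_trans ordIso_symmetric)
  \<comment> \<open>The bound on cuts concerns orders on all of \<open>Field \<kappa>\<close>, so
    the separators are enumerated by \<open>Field \<kappa>\<close>, possibly with repetitions. If
    there are none, the constant empty set is enumerated instead.\<close>
  then have "\<exists>s. D \<subseteq> s ` Field \<kappa> \<and> (\<forall>x\<in>Field \<kappa>. s x \<subseteq> Field \<kappa>)"
  proof (cases "D = {}")
    case True
    then show ?thesis by (intro exI[of _ "\<lambda>_. {}"]) auto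
  next
    case False
    then obtain s where "s ` Field \<kappa> = D"
      using \<open>|D| \<le>o |Field \<kappa>|\<close> card_of_ordLeq2[OF False] by metis
    then show ?thesis
      using D by (intro exI[of _ s]) auto
  qed
  then obtain s where sD: "D \<subseteq> s ` Field \<kappa>" and "\<forall>x\<in>Field \<kappa>. s x \<subseteq> Field \<kappa>"
    by metis
  then have s: "\<And>x. x \<in> Field \<kappa> \<Longrightarrow> s x \<subseteq> Field \<kappa>"
    by blast
  \<comment> \<open>The lexicographic order of the enumerated sets, pulled back to the indices.
    Since the enumeration may repeat, indices of the same set are compared by
    \<open>\<kappa>\<close>.\<close>
  define R where "R = {(x, y). x \<in> Field \<kappa> \<and> y \<in> Field \<kappa> \<and>
    (if s x = s y then (x, y) \<in> \<kappa> else lex_le \<kappa> (s x) (s y))}"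
  have wo': "refl_on (Field \<kappa>) \<kappa>" "trans \<kappa>" "antisym \<kappa>" "total_on (Field \<kappa>) \<kappa>"
    using wo by (auto simp: well_order_on_def linear_order_on_def partial_order_on_def preorder_on_def)
  have "linear_order_on (Field \<kappa>) R"
    unfolding linear_order_on_def partial_order_on_def preorder_on_def
  proof (intro conjI)
    show "refl_on (Field \<kappa>) R"
      using wo'(1) by (auto simp: R_def refl_on_def)
    show "R \<subseteq> Field \<kappa> \<times> Field \<kappa>"
      by (auto simp: R_def)
    show "trans R"
    proof (rule transI)
      fix x y z assume xy: "(x, y) \<in> R" and yz: "(y, z) \<in> R"
      then have fld: "s x \<subseteq> Field \<kappa>" "s y \<subseteq> Field \<kappa>" "s z \<subseteq> Field \<kappa>"
        using s by (auto simp: R_def)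
      have le: "lex_le \<kappa> (s x) (s y)" "lex_le \<kappa> (s y) (s z)"
        using xy yz by (auto simp: R_def lex_le_def split: if_splits)
      show "(x, z) \<in> R"
      proof (cases "s x = s z")
        case True
        then have "s x = s y"
          using lex_le_antisym[OF wo fld(1,2)] le by simp
        then show ?thesis
          using xy yz True transD[OF wo'(2)] by (auto simp: R_def)
      next
        case False
        then show ?thesis
          using xy yz lex_le_trans[OF wo fld le] by (auto simp: R_def)
      qed
    qed
    show "antisym R"
    proof (rule antisymI)
      fix x y assume "(x, y) \<in> R" "(y, x) \<in> R"
      then show "x = y"
        using lex_le_antisym[OF wo s s, of x y] antisymD[OF wo'(3)]
        by (auto simp: R_def split: if_splits)
    qed
    show "total_on (Field \<kappa>) R"
      using lex_le_total[OF wo s s] wo'(4) by (fastforce simp: R_def total_on_def)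
  qed
  then have cuts: "|cuts (Field \<kappa>) R| \<le>o \<delta>" by (rule ded)
  define C where "C f = {x \<in> Field \<kappa>. lex_le \<kappa> (s x) f}" for f
  have C_cut: "C f \<in> cuts (Field \<kappa>) R" if "f \<in> F" for f
  proof -
    have "y \<in> C f" if "x \<in> C f" "(y, x) \<in> R" for x y
    proof -
      have "lex_le \<kappa> (s y) (s x)" "x \<in> Field \<kappa>" "y \<in> Field \<kappa>"
        using that by (auto simp: R_def lex_le_def split: if_splits)
      then show ?thesis
        using lex_le_trans[OF wo s s, of y x f] \<open>f \<in> F\<close> F that by (auto simp: C_def)
    qed
    moreover have "C f \<subseteq> Field \<kappa>" by (auto simp: C_def)
    ultimately show ?thesis unfolding cuts_def by blast
  qed
  \<comment> \<open>The separator \<open>?d\<close> is contained in \<open>g\<close>, hence lies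
    below \<open>g\<close> and, the cuts being equal, below \<open>f\<close>. But \<open>f\<close>
    lies below \<open>?d\<close>, as \<open>i\<close> is their first difference, so
    \<open>f = ?d\<close>, against \<open>i \<notin> f\<close>.\<close>
  have separated: "f \<inter> underS \<kappa> i \<notin> large_nodes \<kappa> \<delta> F i"
    if "f \<in> F" "g \<in> F" "C f = C g" "i \<in> Field \<kappa>" "i \<in> g - f"
      "f \<inter> underS \<kappa> i = g \<inter> underS \<kappa> i" for f g i
  proof
    let ?d = "insert i (f \<inter> underS \<kappa> i)"
    assume "f \<inter> underS \<kappa> i \<in> large_nodes \<kappa> \<delta> F i"
    then have "(i, f \<inter> underS \<kappa> i) \<in> ?N"
      using that by simp
    then have "?d \<in> D"
      unfolding D_def by (intro image_eqI[of _ _ "(i, f \<inter> underS \<kappa> i)"]) simp_all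
    then obtain x where x: "x \<in> Field \<kappa>" "?d = s x"
      using sD by auto
    have fld: "f \<subseteq> Field \<kappa>" "g \<subseteq> Field \<kappa>" using that F by auto
    have "?d \<subseteq> g" using that by auto
    then have "lex_le \<kappa> ?d g" using fld by (intro lex_le_subset[OF wo])
    then have "x \<in> C g" using x by (simp add: C_def)
    then have "x \<in> C f" using that by simp
    then have "lex_le \<kappa> ?d f" using x by (simp add: C_def)
    moreover have "lex_le \<kappa> f ?d"
    proof -
      have "i \<in> ?d - f" "f \<inter> underS \<kappa> i = ?d \<inter> underS \<kappa> i"
        using that by (auto simp: underS_def)
      then show ?thesis unfolding lex_le_def by blast
    qed
    ultimately have "f = ?d"
      using lex_le_antisym[OF wo, of f ?d] fld s[OF x(1)] x(2) by simp
    then show False using that by blast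
  qed
  \<comment> \<open>Any other \<open>g\<close> with the same cut parts from \<open>f\<close> at a
    node that is not large. There are at most \<open>\<kappa>\<close> such nodes along
    \<open>f\<close>, each passed by at most \<open>\<delta>\<close> sets, and
    \<open>\<kappa> \<le>o \<delta>\<close>.\<close>
  have fibre: "|{g \<in> F. C g = C f}| \<le>o \<delta>" if f: "f \<in> F" for f
  proof -
    let ?S = "\<lambda>i. if f \<inter> underS \<kappa> i \<in> large_nodes \<kappa> \<delta> F i then {} else branch \<kappa> F i (f \<inter> underS \<kappa> i)"
    have "{g \<in> F. C g = C f} \<subseteq> {f} \<union> (\<Union>i\<in>Field \<kappa>. ?S i)"
    proof
      fix g assume "g \<in> {g \<in> F. C g = C f}"
      then have g: "g \<in> F" "C g = C f" by auto
      show "g \<in> {f} \<union> (\<Union>i\<in>Field \<kappa>. ?S i)"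
      proof (cases "f = g")
        case False
        obtain i where i: "i \<in> Field \<kappa>" "i \<in> f \<longleftrightarrow> i \<notin> g" "f \<inter> underS \<kappa> i = g \<inter> underS \<kappa> i"
          using least_difference[OF wo _ _ False] f g F by blast
        then have "f \<inter> underS \<kappa> i \<notin> large_nodes \<kappa> \<delta> F i"
          using separated[of f g i] separated[of g f i] f g by (cases "i \<in> f") auto
        then show ?thesis
          using g i by (auto simp: branch_def)
      qed simp
    qed
    then have "|{g \<in> F. C g = C f}| \<le>o |{f} \<union> (\<Union>i\<in>Field \<kappa>. ?S i)|"
      by (rule card_of_mono1)
    also have "|{f} \<union> (\<Union>i\<in>Field \<kappa>. ?S i)| \<le>o \<delta>"
    proof (rule card_of_Un_ordLeq_infinite_Field[OF \<delta>inf])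
      show "|{f}| \<le>o \<delta>"
        using \<delta> \<delta>inf by (metis card_of_singl_ordLeq card_of_Field_ordIso finite.emptyI ordLeq_ordIso_trans)
      have "|?S i| \<le>o \<delta>" for i
        using \<delta> by (auto simp: large_nodes_def card_of_empty1)
      moreover have "|Field \<kappa>| \<le>o \<delta>"
        using \<kappa>\<delta> card_of_Field_ordIso[OF \<kappa>(1)] ordIso_ordLeq_trans by blast
      ultimately show "|\<Union>i\<in>Field \<kappa>. ?S i| \<le>o \<delta>"
        using \<delta> by (intro card_of_UNION_ordLeq_infinite_Field[OF \<delta>inf]) blast+
    qed (rule \<delta>)
    finally show ?thesis .
  qed
  \<comment> \<open>There are at most \<open>\<delta>\<close> cuts, each induced by at most
    \<open>\<delta>\<close> sets.\<close>
  have "F = (\<Union>c\<in>C ` F. {g \<in> F. C g = c})" by auto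
  moreover have "|\<Union>c\<in>C ` F. {g \<in> F. C g = c}| \<le>o \<delta>"
  proof (rule card_of_UNION_ordLeq_infinite_Field[OF \<delta>inf \<delta>])
    have "C ` F \<subseteq> cuts (Field \<kappa>) R" using C_cut by auto
    then show "|C ` F| \<le>o \<delta>"
      by (rule ordLeq_transitive[OF card_of_mono1 cuts])
    show "\<forall>c\<in>C ` F. |{g \<in> F. C g = c}| \<le>o \<delta>"
      using fibre by blast
  qed
  ultimately show ?thesis by simp
qed

section \<open>Shattered finite sets of every size\<close>

definition shatters :: "'a set set \<Rightarrow> 'a set \<Rightarrow> bool" where
  "shatters F w \<longleftrightarrow> (\<forall>V\<subseteq>w. \<exists>f\<in>F. f \<inter> w = V)"

lemma card_of_lists_length:
  assumes "infinite A"
  shows "|{xs. set xs \<subseteq> A \<and> length xs = n}| \<le>o |A|"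
proof (induction n)
  case 0
  have "{xs. set xs \<subseteq> A \<and> length xs = 0} = {[]}" by auto
  then show ?case
    using assms by (metis card_of_singl_ordLeq finite.emptyI)
next
  case (Suc n)
  let ?L = "\<lambda>n. {xs. set xs \<subseteq> A \<and> length xs = n}"
  have "?L (Suc n) = (\<lambda>(x, xs). x # xs) ` (A \<times> ?L n)"
    by (auto simp: length_Suc_conv image_iff)
  then have "|?L (Suc n)| \<le>o |A \<times> ?L n|"
    by (simp only: card_of_image)
  also have "|A \<times> ?L n| \<le>o |A|"
    using Suc assms by (intro card_of_Sigma_ordLeq_infinite) (auto intro: card_of_mono1)
  finally show ?case .
qed

text \<open>
  Some level has more than \<open>\<kappa>\<close> large nodes, so two of them shatter the same set of size \<open>n\<close>; a point
  on which these two nodes differ can be added to it.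
\<close>

lemma shatters_large:
  assumes \<kappa>: "Card_order \<kappa>" "infinite (Field \<kappa>)" and \<delta>: "Card_order \<delta>"
    and ded: "\<And>R. linear_order_on (Field \<kappa>) R \<Longrightarrow> |cuts (Field \<kappa>) R| \<le>o \<delta>"
    and F: "F \<subseteq> Pow (Field \<kappa>)" and large: "\<not> |F| \<le>o \<delta>"
  shows "\<exists>w\<subseteq>Field \<kappa>. finite w \<and> card w = n \<and> shatters F w"
  using F large
proof (induction n arbitrary: F)
  case 0
  then have "F \<noteq> {}" using \<delta> by (auto simp: card_of_empty1)
  then show ?case by (intro exI[of _ "{}"]) (auto simp: shatters_def)
next
  case (Suc n)
  have "|SIGMA i : Field \<kappa>. large_nodes \<kappa> \<delta> F i| \<le>o \<kappa>" if "\<forall>i\<in>Field \<kappa>. |large_nodes \<kappa> \<delta> F i| \<le>o \<kappa>"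
    by (rule card_of_Sigma_ordLeq_infinite_Field
        [OF \<kappa>(2,1) ordIso_imp_ordLeq[OF card_of_Field_ordIso[OF \<kappa>(1)]] that])
  then obtain i where i: "i \<in> Field \<kappa>" "\<not> |large_nodes \<kappa> \<delta> F i| \<le>o \<kappa>"
    using few_large_nodes[OF \<kappa> \<delta> ded Suc.prems(1)] Suc.prems(2) by blast
  \<comment> \<open>The sets through a large node again form a family not bounded by
    \<open>\<delta>\<close>, which is why the induction runs over all families.\<close>
  have "\<exists>w\<subseteq>Field \<kappa>. finite w \<and> card w = n \<and> shatters (branch \<kappa> F i \<eta>) w"
    if "\<eta> \<in> large_nodes \<kappa> \<delta> F i" for \<eta>
    using that Suc.prems by (intro Suc.IH) (auto simp: large_nodes_def branch_def)
  \<comment> \<open>Distinct lists replace sets, so that \<open>card_of_lists_length\<close> counts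
    them.\<close>
  then have "\<exists>ws. set ws \<subseteq> Field \<kappa> \<and> length ws = n \<and> distinct ws \<and> shatters (branch \<kappa> F i \<eta>) (set ws)"
    if "\<eta> \<in> large_nodes \<kappa> \<delta> F i" for \<eta>
    using that finite_distinct_list by (metis distinct_card)
  then obtain ws where ws: "\<And>\<eta>. \<eta> \<in> large_nodes \<kappa> \<delta> F i \<Longrightarrow>
    set (ws \<eta>) \<subseteq> Field \<kappa> \<and> length (ws \<eta>) = n \<and> distinct (ws \<eta>) \<and> shatters (branch \<kappa> F i \<eta>) (set (ws \<eta>))"
    by metis
  have "\<not> inj_on ws (large_nodes \<kappa> \<delta> F i)"
  proof
    assume "inj_on ws (large_nodes \<kappa> \<delta> F i)"
    then have "|large_nodes \<kappa> \<delta> F i| \<le>o |{xs. set xs \<subseteq> Field \<kappa> \<and> length xs = n}|"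
      by (rule card_of_ordLeqI) (use ws in auto)
    also have "|{xs. set xs \<subseteq> Field \<kappa> \<and> length xs = n}| \<le>o |Field \<kappa>|"
      by (rule card_of_lists_length[OF \<kappa>(2)])
    finally have "|large_nodes \<kappa> \<delta> F i| \<le>o \<kappa>"
      by (rule ordLeq_ordIso_trans[OF _ card_of_Field_ordIso[OF \<kappa>(1)]])
    with i(2) show False ..
  qed
  then obtain \<eta> \<nu> where \<eta>\<nu>: "\<eta> \<in> large_nodes \<kappa> \<delta> F i" "\<nu> \<in> large_nodes \<kappa> \<delta> F i" "\<eta> \<noteq> \<nu>" "ws \<eta> = ws \<nu>"
    by (auto simp: inj_on_def)
  define w where "w = set (ws \<eta>)"
  have w: "w \<subseteq> Field \<kappa>" "finite w" "card w = n"
    "shatters (branch \<kappa> F i \<eta>) w" "shatters (branch \<kappa> F i \<nu>) w"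
    using ws[OF \<eta>\<nu>(1)] ws[OF \<eta>\<nu>(2)] \<eta>\<nu>(4) by (auto simp: w_def distinct_card)
  have sub: "\<eta> \<subseteq> underS \<kappa> i" "\<nu> \<subseteq> underS \<kappa> i"
    using large_nodes_subset[OF \<eta>\<nu>(1) \<delta>] large_nodes_subset[OF \<eta>\<nu>(2) \<delta>] by auto
  obtain j where j: "j \<in> \<eta> \<longleftrightarrow> j \<notin> \<nu>"
    using \<eta>\<nu>(3) by blast
  then have jS: "j \<in> underS \<kappa> i" "j \<in> Field \<kappa>"
    using sub by (auto simp: underS_def Field_def)
  have f_j: "j \<in> f \<longleftrightarrow> j \<in> \<rho>" "f \<in> F" if "f \<in> branch \<kappa> F i \<rho>" for f \<rho>
    using that jS by (auto simp: branch_def)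
  \<comment> \<open>All sets in one branch agree on \<open>j\<close>, which lies below level
    \<open>i\<close>; a shattered set containing \<open>j\<close> would need sets that differ
    there.\<close>
  have "j \<notin> w"
  proof
    assume "j \<in> w"
    then obtain f g where "f \<in> branch \<kappa> F i \<eta>" "g \<in> branch \<kappa> F i \<eta>" "f \<inter> w = {j}" "g \<inter> w = {}"
      using w(4) unfolding shatters_def by (meson empty_subsetI insert_subset)
    then show False using f_j \<open>j \<in> w\<close> by blast
  qed
  have "shatters F (insert j w)"
    unfolding shatters_def
  proof (intro allI impI)
    fix V assume V: "V \<subseteq> insert j w"
    \<comment> \<open>\<open>\<rho>\<close> is the node that decides \<open>j\<close> as
      \<open>V\<close> demands; shattering inside its branch takes care of \<open>w\<close>.\<close>
    obtain \<rho> where \<rho>: "\<rho> = \<eta> \<or> \<rho> = \<nu>" "j \<in> \<rho> \<longleftrightarrow> j \<in> V"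
      using j by blast
    then obtain f where "f \<in> branch \<kappa> F i \<rho>" "f \<inter> w = V \<inter> w"
      using w(4,5) unfolding shatters_def by (meson inf_le2)
    then show "\<exists>f\<in>F. f \<inter> insert j w = V"
      using f_j[of f \<rho>] \<rho> V by (intro bexI[of _ f]) auto
  qed
  then show ?case
    using w \<open>j \<notin> w\<close> jS by (intro exI[of _ "insert j w"]) auto
qed

text \<open>Families and shattered sets are transported along an injection of \<open>A\<close> into
  \<open>Field \<kappa>\<close>.\<close>

lemma shatters_large_family:
  assumes \<kappa>: "Card_order \<kappa>" "infinite (Field \<kappa>)" and \<delta>: "Card_order \<delta>"
    and ded: "\<And>R. linear_order_on (Field \<kappa>) R \<Longrightarrow> |cuts (Field \<kappa>) R| \<le>o \<delta>"
    and "|A| \<le>o \<kappa>" and F: "F \<subseteq> Pow A" and large: "\<not> |F| \<le>o \<delta>"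
  shows "\<exists>w\<subseteq>A. finite w \<and> card w = n \<and> shatters F w"
proof -
  have "|A| \<le>o |Field \<kappa>|"
    by (rule ordLeq_ordIso_trans[OF assms(5) ordIso_symmetric[OF card_of_Field_ordIso[OF \<kappa>(1)]]])
  then obtain g where g: "inj_on g A" "g ` A \<subseteq> Field \<kappa>"
    by (auto simp: card_of_ordLeq[symmetric])
  have inj: "inj_on ((`) g) F"
    using F g(1) by (auto intro: inj_on_subset[OF inj_on_image_Pow])
  have "|F| \<le>o |(`) g ` F|"
    by (rule card_of_ordLeqI[OF inj]) simp
  from ordLeq_transitive[OF this] have "\<not> |(`) g ` F| \<le>o \<delta>"
    using large by blast
  moreover have "(`) g ` F \<subseteq> Pow (Field \<kappa>)" using F g by auto
  ultimately obtain w where w: "w \<subseteq> Field \<kappa>" "finite w" "card w = n" "shatters ((`) g ` F) w"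
    using shatters_large[OF \<kappa> \<delta> ded, of "(`) g ` F" n] by blast
  \<comment> \<open>The shattered set lies in the image of \<open>A\<close>, because some member of
    the family has all of \<open>w\<close> as its trace.\<close>
  then obtain f0 where "f0 \<in> F" "g ` f0 \<inter> w = w"
    unfolding shatters_def by blast
  then have "w \<subseteq> g ` A" using F by blast
  then obtain v where v: "v \<subseteq> A" "w = g ` v" by (meson subset_image_iff)
  have "inj_on g v" by (rule inj_on_subset[OF g(1) v(1)])
  then have "finite v" "card v = n"
    using w v by (auto simp: card_image finite_image_iff)
  moreover have "shatters F v"
    unfolding shatters_def
  proof (intro allI impI)
    fix V assume V: "V \<subseteq> v"
    then have "g ` V \<subseteq> w" using v by auto
    then obtain f where f: "f \<in> F" "g ` f \<inter> w = g ` V"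
      using w(4) unfolding shatters_def by blast
    have "f \<subseteq> A" using f F by auto
    then have "g ` (f \<inter> v) = g ` V"
      using f v g(1) by (simp add: inj_on_image_Int)
    then have "f \<inter> v = V"
      using inj_on_image_eq_iff[OF g(1), of "f \<inter> v" V] v V by auto
    then show "\<exists>f\<in>F. f \<inter> v = V" using f by blast
  qed
  ultimately show ?thesis using v by blast
qed

section \<open>Independent patterns and 2-dependence\<close>

text \<open>The pattern is a finite conjunction of instances of \<open>\<phi>\<close> and their
  negations, from which \<open>z\<close> is quantified away. The maps \<open>g\<close> and
  \<open>h\<close> give the blocks in which the tuples stand, since the two families occur in both
  orders later on.\<close>

lemma pattern_formula:
  fixes N K :: nat
  assumes \<phi>: "\<phi> \<in> formulas L (Z @ Y1 @ Y2)" and Xs: "set (concat Xs) \<subseteq> sorts L"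
    and g: "\<And>s. s < N \<Longrightarrow> g s < length Xs \<and> Xs ! g s = Y1"
    and h: "\<And>l. l < K \<Longrightarrow> h l < length Xs \<and> Xs ! h l = Y2"
  shows "\<exists>\<theta>\<in>formulas L (concat Xs). \<forall>bs. list_all2 (\<lambda>as X. as \<in> tuples M X) bs Xs \<longrightarrow>
    sat M (concat bs) \<theta> \<longleftrightarrow>
      (\<exists>z\<in>tuples M Z. \<forall>s<N. \<forall>l<K. sat M (z @ bs ! g s @ bs ! h l) \<phi> \<longleftrightarrow> (s, l) \<in> S)"
proof -
  have Z: "set (Z @ concat Xs) \<subseteq> sorts L"
    using \<phi> Xs by (auto simp: formulas_def)
  let ?P = "{..<N} \<times> {..<K}"
  have "\<exists>\<psi>\<in>formulas L (Z @ concat Xs). \<forall>z\<in>tuples M Z. \<forall>bs. list_all2 (\<lambda>as X. as \<in> tuples M X) bs Xs \<longrightarrow>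
      sat M (z @ concat bs) \<psi> \<longleftrightarrow> sat M (z @ bs ! g s @ bs ! h l) \<phi>"
    if "s < N" "l < K" for s l
  proof -
    \<comment> \<open>\<open>z\<close> becomes block 0, which moves the other blocks by one.\<close>
    have "\<exists>\<psi>\<in>formulas L (concat (Z # Xs)). \<forall>bs. list_all2 (\<lambda>as X. as \<in> tuples M X) bs (Z # Xs) \<longrightarrow>
      sat M (concat bs) \<psi> \<longleftrightarrow> sat M (concat (map ((!) bs) [0, Suc (g s), Suc (h l)])) \<phi>"
      using \<phi> Z g[OF that(1)] h[OF that(2)] by (intro pick_blocks) auto
    then obtain \<psi> where \<psi>: "\<psi> \<in> formulas L (concat (Z # Xs))"
      "\<And>bs. list_all2 (\<lambda>as X. as \<in> tuples M X) bs (Z # Xs) \<Longrightarrow>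
        sat M (concat bs) \<psi> \<longleftrightarrow> sat M (concat (map ((!) bs) [0, Suc (g s), Suc (h l)])) \<phi>"
      by blast
    have "sat M (z @ concat bs) \<psi> \<longleftrightarrow> sat M (z @ bs ! g s @ bs ! h l) \<phi>"
      if "z \<in> tuples M Z" "list_all2 (\<lambda>as X. as \<in> tuples M X) bs Xs" for z bs
      using \<psi>(2)[of "z # bs"] that by simp
    then show ?thesis using \<psi>(1) by auto
  qed
  then obtain \<psi> where \<psi>: "\<And>s l. s < N \<Longrightarrow> l < K \<Longrightarrow> \<psi> s l \<in> formulas L (Z @ concat Xs)"
    "\<And>s l z bs. s < N \<Longrightarrow> l < K \<Longrightarrow> z \<in> tuples M Z \<Longrightarrow> list_all2 (\<lambda>as X. as \<in> tuples M X) bs Xs \<Longrightarrow>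
      sat M (z @ concat bs) (\<psi> s l) \<longleftrightarrow> sat M (z @ bs ! g s @ bs ! h l) \<phi>"
    by metis
  have "\<exists>\<chi>\<in>formulas L (Z @ concat Xs). \<forall>e. sat M e \<chi> \<longleftrightarrow>
      (\<forall>x\<in>?P. sat M e (\<psi> (fst x) (snd x)) \<longleftrightarrow> x \<in> S)"
  proof (rule finite_conjunction)
    fix x assume x: "x \<in> ?P"
    let ?\<psi> = "\<psi> (fst x) (snd x)"
    have "?\<psi> \<in> formulas L (Z @ concat Xs)" using \<psi>(1) x by auto
    then show "\<exists>\<chi>\<in>formulas L (Z @ concat Xs). \<forall>e. sat M e \<chi> \<longleftrightarrow> (sat M e ?\<psi> \<longleftrightarrow> x \<in> S)"
      by (intro bexI[of _ "if x \<in> S then ?\<psi> else Neg ?\<psi>"]) (auto simp: formulas_def)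
  qed (use Z in auto)
  then obtain \<chi> where \<chi>: "\<chi> \<in> formulas L (Z @ concat Xs)"
    "\<And>e. sat M e \<chi> \<longleftrightarrow> (\<forall>x\<in>?P. sat M e (\<psi> (fst x) (snd x)) \<longleftrightarrow> x \<in> S)"
    by blast
  from exists_tuple[OF \<chi>(1), of M] obtain \<theta> where \<theta>: "\<theta> \<in> formulas L (concat Xs)"
    "\<And>e. sat M e \<theta> \<longleftrightarrow> (\<exists>z\<in>tuples M Z. sat M (z @ e) \<chi>)"
    by blast
  have "sat M (concat bs) \<theta> \<longleftrightarrow>
      (\<exists>z\<in>tuples M Z. \<forall>s<N. \<forall>l<K. sat M (z @ bs ! g s @ bs ! h l) \<phi> \<longleftrightarrow> (s, l) \<in> S)"
    if "list_all2 (\<lambda>as X. as \<in> tuples M X) bs Xs" for bs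
    unfolding \<theta>(2) \<chi>(2) using \<psi>(2)[OF _ _ _ that]
    by (intro bex_cong refl) auto
  then show ?thesis using \<theta>(1) by blast
qed

text \<open>The finite form of the failure of 2-dependence, with lists in place of the sequences.
  Only the part of \<open>S\<close> inside the rectangle of indices matters.\<close>

definition independent ::
  "('s, 'f, 'r, 'm) struc \<Rightarrow> 's list \<Rightarrow> ('s, 'f, 'r) fm \<Rightarrow> 'm list list \<Rightarrow> 'm list list \<Rightarrow> bool" where
  "independent M Z \<phi> as bs \<longleftrightarrow> (\<forall>S. \<exists>z\<in>tuples M Z.
     \<forall>s<length as. \<forall>l<length bs. sat M (z @ as ! s @ bs ! l) \<phi> \<longleftrightarrow> (s, l) \<in> S)"

lemma independent_mono:
  assumes "independent M Z \<phi> as bs"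
  shows "independent M Z \<phi> (drop d as) (take k bs)"
  unfolding independent_def
proof
  fix S :: "(nat \<times> nat) set"
  \<comment> \<open>The pattern prescribed for \<open>as\<close> is \<open>S\<close> moved by
    \<open>d\<close>. Truncated subtraction also constrains the dropped entries, which is
    harmless.\<close>
  obtain z where "z \<in> tuples M Z" and z: "\<And>s l. s < length as \<Longrightarrow> l < length bs \<Longrightarrow>
      sat M (z @ as ! s @ bs ! l) \<phi> \<longleftrightarrow> (s - d, l) \<in> S"
    using assms unfolding independent_def
    by (elim allE[of _ "{(s, l). (s - d, l) \<in> S}"]) auto
  then show "\<exists>z\<in>tuples M Z. \<forall>s<length (drop d as). \<forall>l<length (take k bs).
      sat M (z @ drop d as ! s @ take k bs ! l) \<phi> \<longleftrightarrow> (s, l) \<in> S"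
    by (intro bexI[of _ z]) (auto simp: z)
qed

lemma list_all2_replicate_iff:
  "list_all2 P xs (replicate n y) \<longleftrightarrow> length xs = n \<and> (\<forall>x\<in>set xs. P x y)"
  by (auto simp: list_all2_conv_all_nth all_set_conv_all_nth)

text \<open>Only the finitely many patterns inside the rectangle of indices have to be considered,
  so the quantifier over all patterns becomes a finite conjunction.\<close>

lemma independent_formula:
  assumes \<phi>: "\<phi> \<in> formulas L (Z @ Y1 @ Y2)"
  shows "\<exists>\<theta>\<in>formulas L (concat (replicate N Y1) @ concat (replicate K Y2)). \<forall>as bs.
    length as = N \<longrightarrow> set as \<subseteq> tuples M Y1 \<longrightarrow> length bs = K \<longrightarrow> set bs \<subseteq> tuples M Y2 \<longrightarrow>
    sat M (concat as @ concat bs) \<theta> \<longleftrightarrow> independent M Z \<phi> as bs"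
proof -
  let ?Xs = "replicate N Y1 @ replicate K Y2"
  let ?typed = "\<lambda>bs. list_all2 (\<lambda>as X. as \<in> tuples M X) bs ?Xs"
  have Xs: "set (concat ?Xs) \<subseteq> sorts L"
    using \<phi> by (auto simp: formulas_def)
  have "\<forall>S. \<exists>\<theta>\<in>formulas L (concat ?Xs). \<forall>bs. ?typed bs \<longrightarrow>
    sat M (concat bs) \<theta> \<longleftrightarrow>
      (\<exists>z\<in>tuples M Z. \<forall>s<N. \<forall>l<K. sat M (z @ bs ! s @ bs ! (N + l)) \<phi> \<longleftrightarrow> (s, l) \<in> S)"
    by (intro allI pattern_formula[OF \<phi> Xs]) (auto simp: nth_append)
  then obtain \<theta> where \<theta>: "\<And>S. \<theta> S \<in> formulas L (concat ?Xs)"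
    "\<And>S bs. ?typed bs \<Longrightarrow> sat M (concat bs) (\<theta> S) \<longleftrightarrow>
      (\<exists>z\<in>tuples M Z. \<forall>s<N. \<forall>l<K. sat M (z @ bs ! s @ bs ! (N + l)) \<phi> \<longleftrightarrow> (s, l) \<in> S)"
    by metis
  have "\<exists>\<chi>\<in>formulas L (concat ?Xs). \<forall>e. sat M e \<chi> \<longleftrightarrow> (\<forall>S\<in>Pow ({..<N} \<times> {..<K}). sat M e (\<theta> S))"
    using \<theta>(1) Xs by (intro finite_conjunction) auto
  then obtain \<chi> where \<chi>: "\<chi> \<in> formulas L (concat ?Xs)"
    "\<And>e. sat M e \<chi> \<longleftrightarrow> (\<forall>S\<in>Pow ({..<N} \<times> {..<K}). sat M e (\<theta> S))"
    by blast
  have "sat M (concat as @ concat bs) \<chi> \<longleftrightarrow> independent M Z \<phi> as bs"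
    if "length as = N" "set as \<subseteq> tuples M Y1" "length bs = K" "set bs \<subseteq> tuples M Y2" for as bs
  proof -
    have typed: "?typed (as @ bs)"
      using that by (intro list_all2_appendI) (auto simp: list_all2_replicate_iff)
    have "sat M (concat as @ concat bs) \<chi> \<longleftrightarrow> (\<forall>S\<in>Pow ({..<N} \<times> {..<K}).
        \<exists>z\<in>tuples M Z. \<forall>s<N. \<forall>l<K. sat M (z @ as ! s @ bs ! l) \<phi> \<longleftrightarrow> (s, l) \<in> S)"
      using \<theta>(2)[OF typed] that(1) by (simp add: \<chi>(2) nth_append)
    also have "\<dots> \<longleftrightarrow> independent M Z \<phi> as bs"
    proof
      assume *: "\<forall>S\<in>Pow ({..<N} \<times> {..<K}).
        \<exists>z\<in>tuples M Z. \<forall>s<N. \<forall>l<K. sat M (z @ as ! s @ bs ! l) \<phi> \<longleftrightarrow> (s, l) \<in> S"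
      show "independent M Z \<phi> as bs"
        unfolding independent_def
      proof
        fix S :: "(nat \<times> nat) set"
        show "\<exists>z\<in>tuples M Z. \<forall>s<length as. \<forall>l<length bs. sat M (z @ as ! s @ bs ! l) \<phi> \<longleftrightarrow> (s, l) \<in> S"
          using *[rule_format, of "S \<inter> {..<N} \<times> {..<K}"] that by auto
      qed
    qed (use that in \<open>auto simp: independent_def\<close>)
    finally show ?thesis .
  qed
  then show ?thesis using \<chi>(1) by (intro bexI[of _ \<chi>]) simp_all
qed

section \<open>From finite patterns to infinite ones by saturation\<close>

lemma tuples_replicate:
  "as \<in> tuples M (concat (replicate n X)) \<longleftrightarrow>
    (\<exists>bs. length bs = n \<and> set bs \<subseteq> tuples M X \<and> as = concat bs)"
proof (induction n arbitrary: as)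
  case (Suc n)
  show ?case
  proof
    assume "as \<in> tuples M (concat (replicate (Suc n) X))"
    then obtain x ys where "x \<in> tuples M X" "ys \<in> tuples M (concat (replicate n X))" "as = x @ ys"
      by (auto simp: tuples_def list_all2_append2)
    then show "\<exists>bs. length bs = Suc n \<and> set bs \<subseteq> tuples M X \<and> as = concat bs"
      unfolding Suc by (metis concat.simps(2) insert_subset length_Cons list.simps(15))
  next
    assume "\<exists>bs. length bs = Suc n \<and> set bs \<subseteq> tuples M X \<and> as = concat bs"
    then obtain x bs where "x \<in> tuples M X" "length bs = n" "set bs \<subseteq> tuples M X" "as = x @ concat bs"
      by (auto simp: length_Suc_conv)
    then show "as \<in> tuples M (concat (replicate (Suc n) X))"
      using Suc[of "concat bs"] by (auto intro: tuples_append)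
  qed
qed auto

lemma card_of_UN_nat:
  assumes "natLeq <o \<mu>"
  shows "|\<Union>i::nat. set (f i)| <o \<mu>"
proof -
  have "|\<Union>i::nat. set (f i)| \<le>o |UNIV :: nat set|"
  proof (rule card_of_UNION_ordLeq_infinite)
    have "|set (f i)| <o natLeq" for i
      by (simp add: finite_iff_ordLess_natLeq[symmetric])
    then show "\<forall>i\<in>UNIV. |set (f i)| \<le>o |UNIV :: nat set|"
      using ordLess_imp_ordLeq ordLeq_ordIso_trans ordIso_symmetric[OF card_of_nat] by blast
  qed (auto intro: card_of_mono1)
  then show ?thesis
    using assms card_of_nat ordLeq_ordIso_trans ordLeq_ordLess_trans by blast
qed

text \<open>A sequence of finite lists has at most countably many entries, and \<open>\<mu>\<close>
  is uncountable, so saturation applies to such parameters.\<close>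

lemma saturatedD:
  assumes "saturated L \<mu> M" and "natLeq <o \<mu>"
    and "\<And>i::nat. set (q i) \<subseteq> elems M"
    and "p \<subseteq> param_formulas L M X (\<Union>i. set (q i))"
    and "\<And>p0. p0 \<subseteq> p \<Longrightarrow> finite p0 \<Longrightarrow> \<exists>e\<in>tuples M X. realizes M e p0"
  shows "\<exists>e\<in>tuples M X. realizes M e p"
  using assms card_of_UN_nat[OF assms(2), of q] unfolding saturated_def
  by (elim allE[of _ "\<Union>i. set (q i)"] allE[of _ X] allE[of _ p]) blast

text \<open>
  Lists grow at the front, so that the tuples still to be found come first and are exactly those
  bound by \<open>exists_tuple\<close>.
\<close>

definition extensible ::
  "('s, 'f, 'r, 'm) struc \<Rightarrow> 's list \<Rightarrow> 's list \<Rightarrow> ('s, 'f, 'r) fm \<Rightarrow> (nat \<Rightarrow> 'm list) \<Rightarrow>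
   'm list list \<Rightarrow> bool" where
  "extensible M Z Y1 \<phi> b as \<longleftrightarrow> set as \<subseteq> tuples M Y1 \<and>
     (\<forall>n K. \<exists>as'. length as' = n \<and> set as' \<subseteq> tuples M Y1 \<and>
        independent M Z \<phi> (as' @ as) (map b [0..<K]))"

text \<open>For fixed \<open>n\<close> and \<open>K\<close>, what is required of \<open>x\<close> is
  first-order, since the remaining \<open>n\<close> tuples can be quantified. Requirements for
  larger \<open>n\<close> and \<open>K\<close> imply those for smaller ones, so finitely many hold
  together, and saturation gives one \<open>x\<close> for all.\<close>

lemma extensible_Cons:
  assumes sat: "saturated L \<mu> M" "natLeq <o \<mu>"
    and \<phi>: "\<phi> \<in> formulas L (Z @ Y1 @ Y2)"
    and b: "\<And>j. b j \<in> tuples M Y2"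
    and ext: "extensible M Z Y1 \<phi> b as"
  shows "\<exists>x\<in>tuples M Y1. extensible M Z Y1 \<phi> b (x # as)"
proof -
  let ?C = "\<lambda>n X. concat (replicate n X)"
  let ?bs = "\<lambda>K. map b [0..<K]"
  define k where "k = length as"
  have as: "set as \<subseteq> tuples M Y1" using ext by (simp add: extensible_def)
  let ?Q = "\<lambda>n K x. \<exists>as'. length as' = n \<and> set as' \<subseteq> tuples M Y1 \<and>
    independent M Z \<phi> (as' @ x # as) (?bs K)"
  have "\<exists>\<theta>\<in>formulas L (Y1 @ ?C k Y1 @ ?C K Y2). \<forall>x\<in>tuples M Y1.
    sat M (x @ concat as @ concat (?bs K)) \<theta> \<longleftrightarrow> ?Q n K x" for n K
  proof -
    \<comment> \<open>The \<open>n\<close> tuples still to be found come first in the context, ready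
      for \<open>exists_tuple\<close>; then \<open>x\<close>, the tuples fixed already, and the
      terms of \<open>b\<close>.\<close>
    have eq: "?C (n + Suc k) Y1 @ ?C K Y2 = ?C n Y1 @ Y1 @ ?C k Y1 @ ?C K Y2"
      by (simp only: replicate_add replicate_Suc concat_append concat.simps append_assoc)
    from independent_formula[OF \<phi>, of "n + Suc k" K M] obtain \<psi> where
      \<psi>: "\<psi> \<in> formulas L (?C n Y1 @ Y1 @ ?C k Y1 @ ?C K Y2)"
      "\<And>as bs. length as = n + Suc k \<Longrightarrow> set as \<subseteq> tuples M Y1 \<Longrightarrow> length bs = K \<Longrightarrow>
        set bs \<subseteq> tuples M Y2 \<Longrightarrow> sat M (concat as @ concat bs) \<psi> \<longleftrightarrow> independent M Z \<phi> as bs"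
      unfolding eq by blast
    from exists_tuple[OF \<psi>(1), of M] obtain \<theta> where
      \<theta>: "\<theta> \<in> formulas L (Y1 @ ?C k Y1 @ ?C K Y2)"
      "\<And>e. sat M e \<theta> \<longleftrightarrow> (\<exists>z\<in>tuples M (?C n Y1). sat M (z @ e) \<psi>)" by blast
    have *: "sat M (concat as' @ x @ concat as @ concat (?bs K)) \<psi> \<longleftrightarrow> independent M Z \<phi> (as' @ x # as) (?bs K)"
      if "x \<in> tuples M Y1" "length as' = n" "set as' \<subseteq> tuples M Y1" for x as'
      using \<psi>(2)[of "as' @ x # as" "?bs K"] that as b by (auto simp: k_def)
    have "sat M (x @ concat as @ concat (?bs K)) \<theta> \<longleftrightarrow> ?Q n K x"
      if "x \<in> tuples M Y1" for x
      unfolding \<theta>(2) Bex_def tuples_replicate using *[OF that] by blast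
    then show ?thesis
      using \<theta>(1) by blast
  qed
  then have "\<forall>n K. \<exists>\<theta>. \<theta> \<in> formulas L (Y1 @ ?C k Y1 @ ?C K Y2) \<and>
    (\<forall>x\<in>tuples M Y1. sat M (x @ concat as @ concat (?bs K)) \<theta> \<longleftrightarrow> ?Q n K x)"
    unfolding Bex_def by (intro allI)
  then obtain \<theta> where "\<forall>n K. \<theta> n K \<in> formulas L (Y1 @ ?C k Y1 @ ?C K Y2) \<and>
    (\<forall>x\<in>tuples M Y1. sat M (x @ concat as @ concat (?bs K)) (\<theta> n K) \<longleftrightarrow> ?Q n K x)"
    unfolding choice_iff by (elim exE)
  then have \<theta>: "\<theta> n K \<in> formulas L (Y1 @ ?C k Y1 @ ?C K Y2)"
    "x \<in> tuples M Y1 \<Longrightarrow> sat M (x @ concat as @ concat (?bs K)) (\<theta> n K) \<longleftrightarrow> ?Q n K x" for n K x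
    by simp_all
  define q where "q K = concat as @ concat (?bs K)" for K
  define F where "F = (\<lambda>(n, K). (\<theta> n K, q K))"
  have q: "q K \<in> tuples M (?C k Y1 @ ?C K Y2)" for K
    unfolding q_def
  proof (rule tuples_append)
    show "concat as \<in> tuples M (?C k Y1)"
      unfolding tuples_replicate using as by (intro exI[of _ as]) (simp add: k_def)
    show "concat (?bs K) \<in> tuples M (?C K Y2)"
      unfolding tuples_replicate using b by (intro exI[of _ "?bs K"]) auto
  qed
  have "\<exists>x\<in>tuples M Y1. realizes M x (range F)"
  proof (rule saturatedD[OF sat])
    show "set (q i) \<subseteq> elems M" for i
      using tuples_elems[OF q] .
    show "range F \<subseteq> param_formulas L M Y1 (\<Union>i. set (q i))"
      using q \<theta>(1) by (fastforce simp: F_def param_formulas_def)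
    fix p0 assume "p0 \<subseteq> range F" "finite p0"
    then obtain D where D: "finite D" "p0 = F ` D"
      by (meson finite_subset_image)
    \<comment> \<open>\<open>m\<close> bounds all demands in the finite part; \<open>Suc m\<close>
      new tuples are taken, since one of them becomes \<open>x\<close>.\<close>
    define m where "m = Max (insert 0 (fst ` D \<union> snd ` D))"
    have m: "n \<le> m \<and> K \<le> m" if "(n, K) \<in> D" for n K
      unfolding m_def using that D(1) by (force intro!: Max_ge)
    obtain as' where as': "length as' = Suc m" "set as' \<subseteq> tuples M Y1"
      "independent M Z \<phi> (as' @ as) (?bs m)"
      using ext unfolding extensible_def by blast
    \<comment> \<open>\<open>x\<close> is the new tuple next to \<open>as\<close>; for a demand with
      \<open>n\<close> further tuples, all but the last \<open>n\<close> of \<open>us\<close> are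
      dropped.\<close>
    obtain us x where us: "as' = us @ [x]" "length us = m"
      using as'(1) by (cases as' rule: rev_cases) auto
    have "sat M (x @ q K) (\<theta> n K)" if "(n, K) \<in> D" for n K
    proof -
      have "independent M Z \<phi> (drop (m - n) (us @ x # as)) (take K (?bs m))"
        using as'(3) us by (intro independent_mono) simp
      then have "independent M Z \<phi> (drop (m - n) us @ x # as) (?bs K)"
        using m[OF that] us by (simp add: take_map)
      moreover have "length (drop (m - n) us) = n" "set (drop (m - n) us) \<subseteq> tuples M Y1"
        using m[OF that] us as'(2) by (auto dest: in_set_dropD)
      ultimately show ?thesis
        unfolding q_def using \<theta>(2)[of x K n] as'(2) us by auto
    qed
    then show "\<exists>x\<in>tuples M Y1. realizes M x p0"
      using as'(2) us by (intro bexI[of _ x]) (auto simp: realizes_def D(2) F_def)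
  qed
  then obtain x where x: "x \<in> tuples M Y1" "realizes M x (range F)" by blast
  have "sat M (x @ q K) (\<theta> n K)" for n K
    using x(2) by (auto simp: realizes_def F_def)
  then show ?thesis
    using x(1) as \<theta>(2)[OF x(1)] by (intro bexI[of _ x]) (auto simp: extensible_def q_def)
qed

text \<open>Saturation enters twice: iterating \<open>extensible_Cons\<close> builds the infinite
  sequence that goes with \<open>b\<close>, and then every infinite pattern is realized because its
  finite parts are.\<close>

lemma not_two_dependent_if_extensible:
  fixes M :: "('s, 'f, 'r, 'm) struc"
  assumes "is_model L T M" and sat: "saturated L \<mu> M" "natLeq <o \<mu>"
    and \<phi>: "\<phi> \<in> formulas L (Z @ Y1 @ Y2)"
    and b: "\<And>j. b j \<in> tuples M Y2"
    and ext: "extensible M Z Y1 \<phi> b []"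
  shows "not_two_dependent_formula TYPE('m) L T Z Y1 Y2 \<phi>"
proof -
  \<comment> \<open>The clause for \<open>n = 0\<close> makes the chain of lists start with the
    empty list.\<close>
  have "\<exists>g. \<forall>n. (extensible M Z Y1 \<phi> b (g n) \<and> (n = 0 \<longrightarrow> g n = [])) \<and> (\<exists>x. g (Suc n) = x # g n)"
  proof (rule dependent_nat_choice)
    show "\<exists>y. (extensible M Z Y1 \<phi> b y \<and> (Suc n = 0 \<longrightarrow> y = [])) \<and> (\<exists>x. y = x # as)"
      if "extensible M Z Y1 \<phi> b as \<and> (n = 0 \<longrightarrow> as = [])" for as n
      using extensible_Cons[OF sat \<phi>, of b as] b that by blast
  qed (use ext in blast)
  then obtain g where g_ext: "\<And>n. extensible M Z Y1 \<phi> b (g n)" and g0: "g 0 = []"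
    and g_Suc: "\<And>n. \<exists>x. g (Suc n) = x # g n"
    by blast
  define a where "a i = hd (g (Suc i))" for i
  have "g (Suc n) = a n # g n" for n
    using g_Suc[of n] by (auto simp: a_def)
  then have g_eq: "g n = rev (map a [0..<n])" for n
    by (induction n) (simp_all add: g0)
  have a: "a i \<in> tuples M Y1" for i
    using g_ext[of "Suc i"] by (simp add: g_eq extensible_def)
  have finite_pattern: "\<exists>z\<in>tuples M Z. \<forall>i<m. \<forall>j<m. sat M (z @ a i @ b j) \<phi> \<longleftrightarrow> (i, j) \<in> S" for m S
  proof -
    have "independent M Z \<phi> (g m) (map b [0..<m])"
      using g_ext[of m] unfolding extensible_def by (metis append_Nil length_0_conv)
    \<comment> \<open>\<open>g m\<close> lists the tuples in reverse order, so position
      \<open>s\<close> holds \<open>a (m - Suc s)\<close>.\<close>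
    then obtain z where "z \<in> tuples M Z" and z: "\<And>s l. s < m \<Longrightarrow> l < m \<Longrightarrow>
        sat M (z @ g m ! s @ b l) \<phi> \<longleftrightarrow> (m - Suc s, l) \<in> S"
      unfolding independent_def
      by (elim allE[of _ "{(s, l). (m - Suc s, l) \<in> S}"]) (auto simp: g_eq)
    moreover have "sat M (z @ a i @ b j) \<phi> \<longleftrightarrow> (i, j) \<in> S" if "i < m" "j < m" for i j
      using z[of "m - Suc i" j] that by (simp add: g_eq rev_nth)
    ultimately show ?thesis by blast
  qed
  have "\<exists>z\<in>tuples M Z. \<forall>i j. sat M (z @ a i @ b j) \<phi> \<longleftrightarrow> (i, j) \<in> S" for S
  proof -
    define F where "F = (\<lambda>(i, j). (if (i, j) \<in> S then \<phi> else Neg \<phi>, a i @ b j))"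
    have "\<exists>z\<in>tuples M Z. realizes M z (range F)"
    \<comment> \<open>The coordinates of all parameters \<open>a i @ b j\<close> already occur in
      the diagonal tuples \<open>a i @ b i\<close>.\<close>
    proof (rule saturatedD[OF sat, of "\<lambda>i. a i @ b i"])
      show "set (a i @ b i) \<subseteq> elems M" for i
        using tuples_elems[OF a] tuples_elems[OF b] by auto
      have ab: "a i @ b j \<in> tuples M (Y1 @ Y2)" for i j
        using a b by (rule tuples_append)
      have "Neg \<phi> \<in> formulas L (Z @ Y1 @ Y2)" using \<phi> by (auto simp: formulas_def)
      then show "range F \<subseteq> param_formulas L M Z (\<Union>i. set (a i @ b i))"
        using \<phi> ab by (fastforce simp: F_def param_formulas_def)
      fix p0 assume "p0 \<subseteq> range F" "finite p0"
      then obtain D where D: "finite D" "p0 = F ` D"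
        by (meson finite_subset_image)
      define m where "m = Suc (Max (insert 0 (fst ` D \<union> snd ` D)))"
      have m: "i < m \<and> j < m" if "(i, j) \<in> D" for i j
        unfolding m_def using that D(1) by (force intro!: Max_ge le_imp_less_Suc)
      obtain z where z: "z \<in> tuples M Z" "\<forall>i<m. \<forall>j<m. sat M (z @ a i @ b j) \<phi> \<longleftrightarrow> (i, j) \<in> S"
        using finite_pattern[of m S] by blast
      show "\<exists>z\<in>tuples M Z. realizes M z p0"
        using z m by (intro bexI[of _ z]) (auto simp: realizes_def D(2) F_def)
    qed
    then obtain z where z: "z \<in> tuples M Z" "realizes M z (range F)" by blast
    have *: "sat M (z @ a i @ b j) (if (i, j) \<in> S then \<phi> else Neg \<phi>)" for i j
      using z(2) by (force simp: realizes_def F_def)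
    have "sat M (z @ a i @ b j) \<phi> \<longleftrightarrow> (i, j) \<in> S" for i j
      using *[of i j] by (simp split: if_splits)
    with z(1) show ?thesis by blast
  qed
  then show ?thesis
    unfolding not_two_dependent_formula_def using assms(1) a b by blast
qed

section \<open>Counting types\<close>

lemma regularCard_bounded:
  assumes "Card_order r" and "regularCard r" and "|A| <o r" and "f ` A \<subseteq> Field r"
  shows "\<exists>\<beta>\<in>Field r. \<forall>x\<in>A. (f x, \<beta>) \<in> r"
proof -
  have wo: "wo_rel r" using assms(1) by (rule Card_order_wo_rel)
  have "|f ` A| <o r"
    by (rule ordLeq_ordLess_trans[OF card_of_image assms(3)])
  \<comment> \<open>By regularity a cofinal subset would have the cardinality of
    \<open>r\<close>.\<close>
  then have "\<not> cofinal (f ` A) r"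
    using assms(2,4) not_ordLess_ordIso unfolding regularCard_def by blast
  then obtain \<beta> where \<beta>: "\<beta> \<in> Field r" "\<And>x. x \<in> A \<Longrightarrow> \<not> (\<beta> \<noteq> f x \<and> (\<beta>, f x) \<in> r)"
    unfolding cofinal_def by blast
  have "(f x, \<beta>) \<in> r" if "x \<in> A" for x
    using wo_rel.TOTALS[OF wo] \<beta>(1) \<beta>(2)[OF that] assms(4) that by blast
  with \<beta>(1) show ?thesis by blast
qed

lemma strictly_less_trans:
  assumes "Well_order r" and "(i, j) \<in> r" and "strictly_less r j k"
  shows "strictly_less r i k"
proof -
  have "wo_rel r" using assms(1) by (simp add: wo_rel_def)
  then have "trans r" "antisym r"
    by (simp_all add: wo_rel.TRANS wo_rel.ANTISYM)
  then show ?thesis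
    using assms(2,3) unfolding strictly_less_def by (meson antisymD transD)
qed

text \<open>Every trace on \<open>w\<close> occurs beyond every index, so the prescribed traces can
  be found one after the other, each beyond the previous one.\<close>

lemma increasing_pattern:
  assumes wo: "Well_order r"
    and pat: "\<And>\<beta> V. \<beta> \<in> Field r \<Longrightarrow> V \<subseteq> w \<Longrightarrow> \<exists>j. strictly_less r \<beta> j \<and> f j \<inter> w = V"
    and "\<beta> \<in> Field r"
  shows "\<exists>js. length js = k \<and> increasing r js \<and> (\<forall>j\<in>set js. strictly_less r \<beta> j) \<and>
    (\<forall>l<k. f (js ! l) \<inter> w = S l \<inter> w)"
  using assms(3)
proof (induction k arbitrary: \<beta> S)
  case 0
  then show ?case by (simp add: increasing_def)
next
  case (Suc k)
  obtain j where j: "strictly_less r \<beta> j" "f j \<inter> w = S 0 \<inter> w"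
    using pat[OF Suc.prems, of "S 0 \<inter> w"] by auto
  then have "j \<in> Field r" by (auto simp: strictly_less_def Field_def)
  from Suc.IH[OF this, of "\<lambda>l. S (Suc l)"] obtain js where js: "length js = k" "increasing r js"
    "\<forall>i\<in>set js. strictly_less r j i" "\<forall>l<k. f (js ! l) \<inter> w = S (Suc l) \<inter> w"
    by blast
  have "strictly_less r \<beta> i" if "strictly_less r j i" for i
    using strictly_less_trans[OF wo _ that] j(1) by (simp add: strictly_less_def)
  moreover have "f ((j # js) ! l) \<inter> w = S l \<inter> w" if "l < Suc k" for l
    using js(4) j(2) that by (cases l) simp_all
  ultimately show ?case
    using js(1,2,3) j(1) \<open>j \<in> Field r\<close>
    by (intro exI[of _ "j # js"]) (auto simp: increasing_def)
qed

lemma increasing_sequence: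
  assumes "Card_order r" and "infinite (Field r)"
  shows "\<exists>e :: nat \<Rightarrow> 'i. \<forall>k. increasing r (map e [0..<k])"
proof -
  have wo: "Well_order r" using assms(1) by (rule Card_order_wo_rel[unfolded wo_rel_def])
  have "\<exists>e. \<forall>n. (e n \<in> Field r) \<and> strictly_less r (e n) (e (Suc n))"
  proof (rule dependent_nat_choice)
    show "\<exists>x. x \<in> Field r" using assms(2) by (metis ex_in_conv finite.emptyI)
    show "\<exists>y. y \<in> Field r \<and> strictly_less r x y" if "x \<in> Field r" for x
      using infinite_Card_order_limit[OF assms that] by (auto simp: strictly_less_def)
  qed
  then obtain e :: "nat \<Rightarrow> 'i" where e: "\<And>n. e n \<in> Field r" "\<And>n. strictly_less r (e n) (e (Suc n))"
    by blast
  have less: "strictly_less r (e m) (e (Suc (m + n)))" for m n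
  proof (induction n)
    case (Suc n)
    then show ?case
      using strictly_less_trans[OF wo _ e(2)[of "Suc (m + n)"]] by (simp add: strictly_less_def)
  qed (simp add: e)
  have "strictly_less r (e m) (e n)" if "m < n" for m n
    using less[of m "n - Suc m"] that by simp
  then show ?thesis
    using e(1) by (intro exI[of _ e]) (auto simp: increasing_def sorted_wrt_iff_nth_less)
qed

text \<open>By \<open>pat\<close> each pattern is realized over some increasing tuple from
  \<open>b\<close>, which may depend on the pattern. Being realizable is a formula about this tuple
  with parameters from \<open>A\<close>, so by indiscernibility it passes to the fixed tuple
  \<open>js\<close>; the witness \<open>z\<close> may change.\<close>

lemma independent_of_indiscernible:
  assumes indisc: "indiscernible_over L M Y r b A"
    and \<phi>: "\<phi> \<in> formulas L (Z @ Y1 @ Y)"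
    and as: "set as \<subseteq> tuples M Y1" "set (concat as) \<subseteq> A"
    and b: "\<And>j. j \<in> Field r \<Longrightarrow> b j \<in> tuples M Y"
    and js: "increasing r js"
    and pat: "\<And>S. \<exists>is. increasing r is \<and> length is = length js \<and> (\<exists>z\<in>tuples M Z.
      \<forall>s<length as. \<forall>l<length js. sat M (z @ as ! s @ b (is ! l)) \<phi> \<longleftrightarrow> (s, l) \<in> S)"
  shows "independent M Z \<phi> as (map b js)"
  unfolding independent_def
proof
  fix S :: "(nat \<times> nat) set"
  let ?N = "length as" and ?K = "length js"
  let ?Xs = "replicate ?K Y @ replicate ?N Y1"
  have Xs: "set (concat ?Xs) \<subseteq> sorts L" using \<phi> by (auto simp: formulas_def)
  have "\<exists>\<theta>\<in>formulas L (concat ?Xs). \<forall>bs. list_all2 (\<lambda>as X. as \<in> tuples M X) bs ?Xs \<longrightarrow>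
    sat M (concat bs) \<theta> \<longleftrightarrow>
      (\<exists>z\<in>tuples M Z. \<forall>s<?N. \<forall>l<?K. sat M (z @ bs ! (?K + s) @ bs ! l) \<phi> \<longleftrightarrow> (s, l) \<in> S)"
    by (rule pattern_formula[OF \<phi> Xs]) (auto simp: nth_append)
  then obtain \<theta> where \<theta>: "\<theta> \<in> formulas L (concat ?Xs)"
    "\<And>bs. list_all2 (\<lambda>as X. as \<in> tuples M X) bs ?Xs \<Longrightarrow> sat M (concat bs) \<theta> \<longleftrightarrow>
      (\<exists>z\<in>tuples M Z. \<forall>s<?N. \<forall>l<?K. sat M (z @ bs ! (?K + s) @ bs ! l) \<phi> \<longleftrightarrow> (s, l) \<in> S)"
    by blast
  have sat_\<theta>: "sat M (concat (map b is) @ concat as) \<theta> \<longleftrightarrow>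
      (\<exists>z\<in>tuples M Z. \<forall>s<?N. \<forall>l<?K. sat M (z @ as ! s @ b (is ! l)) \<phi> \<longleftrightarrow> (s, l) \<in> S)"
    if "increasing r is" "length is = ?K" for "is"
  proof -
    have "list_all2 (\<lambda>as X. as \<in> tuples M X) (map b is @ as) ?Xs"
      using that as b by (intro list_all2_appendI) (auto simp: list_all2_replicate_iff increasing_def)
    from \<theta>(2)[OF this] show ?thesis
      using that by (simp add: nth_append)
  qed
  obtain "is" where "is": "increasing r is" "length is = ?K" "sat M (concat (map b is) @ concat as) \<theta>"
    using pat[of S] sat_\<theta> by blast
  have "concat as \<in> tuples M (concat (replicate ?N Y1))"
    using as(1) by (auto simp: tuples_replicate)
  then have "(\<theta>, concat as) \<in> param_formulas L M (concat (replicate (length is) Y)) A"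
    using \<theta>(1) as(2) "is"(2) by (auto simp: param_formulas_def)
  then have "sat M (concat (map b js) @ concat as) \<theta>"
    using indisc "is" js unfolding indiscernible_over_def by blast
  then show "\<exists>z\<in>tuples M Z. \<forall>s<length as. \<forall>l<length (map b js).
      sat M (z @ as ! s @ map b js ! l) \<phi> \<longleftrightarrow> (s, l) \<in> S"
    using sat_\<theta>[OF js] by simp
qed

section \<open>Traces of a tail for a single formula\<close>

lemma shatters_mono: "shatters F w \<Longrightarrow> F \<subseteq> G \<Longrightarrow> shatters G w"
  unfolding shatters_def by (meson subsetD)

text \<open>A whole tuple \<open>concat (map a t)\<close> takes the place of one parameter, so that
  2-dependence applies to \<open>\<phi>\<close> partitioned into \<open>Z\<close>, \<open>p\<close>
  copies of \<open>X\<close>, and \<open>Y\<close>.\<close>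

lemma few_traces:
  fixes M :: "('s, 'f, 'r, 'm) struc" and \<delta> :: "'d rel" and \<kappa> :: "'k rel" and lam :: "'l rel"
  assumes "is_model L T M" and sat: "saturated L \<mu> M" "natLeq <o \<mu>"
    and dep: "two_dependent TYPE('m) L T"
    and \<kappa>: "Card_order \<kappa>" "infinite (Field \<kappa>)"
    and lam: "Card_order lam" "regularCard lam" "\<kappa> <o lam"
    and \<delta>: "Card_order \<delta>"
    and ded: "\<And>R. linear_order_on (Field \<kappa>) R \<Longrightarrow> |cuts (Field \<kappa>) R| \<le>o \<delta>"
    and a: "\<And>i. i \<in> Field \<kappa> \<Longrightarrow> a i \<in> tuples M X"
    and b: "\<And>j. j \<in> Field lam \<Longrightarrow> b j \<in> tuples M Y"
    and c: "c \<in> tuples M Z"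
    and indisc: "indiscernible_over L M Y lam b (coords (a ` Field \<kappa>))"
    and \<phi>: "\<phi> \<in> formulas L (Z @ concat (replicate p X) @ Y)"
    and f_def: "\<And>j. f j = {t. set t \<subseteq> Field \<kappa> \<and> length t = p \<and> sat M (c @ concat (map a t) @ b j) \<phi>}"
  shows "\<exists>\<beta>\<in>Field lam. |f ` {j. strictly_less lam \<beta> j}| \<le>o \<delta>"
proof (rule ccontr)
  assume "\<not> ?thesis"
  then have large: "\<not> |f ` {j. strictly_less lam \<beta> j}| \<le>o \<delta>" if "\<beta> \<in> Field lam" for \<beta>
    using that by simp
  have lam_inf: "infinite (Field lam)"
    by (rule card_of_ordLeq_infinite[OF card_of_mono2[OF ordLess_imp_ordLeq[OF lam(3)]] \<kappa>(2)])
  have wo: "Well_order lam" using lam(1) by (rule Card_order_wo_rel[unfolded wo_rel_def])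
  define I where "I = {t. set t \<subseteq> Field \<kappa> \<and> length t = p}"
  have I: "|I| \<le>o \<kappa>"
    unfolding I_def
    by (rule ordLeq_ordIso_trans[OF card_of_lists_length[OF \<kappa>(2)] card_of_Field_ordIso[OF \<kappa>(1)]])
  \<comment> \<open>One list serves all tails at once. Otherwise each list fails for some tail. As
    there are fewer than \<open>lam\<close> lists, these tails have a common bound
    \<open>\<beta>0\<close>; but the tail beyond \<open>\<beta>0\<close> shatters some list, and
    then so does the larger tail belonging to that list.\<close>
  have shattered: "\<exists>ws. set ws \<subseteq> I \<and> length ws = n \<and>
      (\<forall>\<beta>\<in>Field lam. shatters (f ` {j. strictly_less lam \<beta> j}) (set ws)) \<and> distinct ws" for n
  proof (rule ccontr)
    let ?W = "{ws. set ws \<subseteq> I \<and> length ws = n \<and> distinct ws}"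
    assume "\<not> ?thesis"
    then have "\<forall>ws\<in>?W. \<exists>\<beta>. \<beta> \<in> Field lam \<and> \<not> shatters (f ` {j. strictly_less lam \<beta> j}) (set ws)"
      by auto
    then obtain \<beta> where *: "\<forall>ws\<in>?W. \<beta> ws \<in> Field lam \<and>
        \<not> shatters (f ` {j. strictly_less lam (\<beta> ws) j}) (set ws)"
      unfolding bchoice_iff by (elim exE)
    have \<beta>: "\<beta> ws \<in> Field lam" "\<not> shatters (f ` {j. strictly_less lam (\<beta> ws) j}) (set ws)"
      if "ws \<in> ?W" for ws
      using bspec[OF * that] by simp_all
    \<comment> \<open>\<open>I\<close> may be finite, as for \<open>p = 0\<close>, so lists over
      \<open>I\<close> are counted through lists over the infinite set
      \<open>Field \<kappa>\<close>.\<close>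
    obtain h where h: "inj_on h I" "h ` I \<subseteq> Field \<kappa>"
      using card_of_mono2[OF I] by (auto simp: card_of_ordLeq[symmetric] Field_card_of)
    have "inj_on (map h) ?W"
      by (rule inj_on_subset[OF inj_on_mapI[of h ?W]]) (use h(1) in \<open>auto intro: inj_on_subset\<close>)
    then have "|?W| \<le>o |{xs. set xs \<subseteq> Field \<kappa> \<and> length xs = n}|"
      by (rule card_of_ordLeqI) (use h(2) in auto)
    from ordLeq_ordIso_trans[OF ordLeq_transitive[OF this card_of_lists_length[OF \<kappa>(2)]]
        card_of_Field_ordIso[OF \<kappa>(1)]]
    have "|?W| <o lam"
      by (rule ordLeq_ordLess_trans[OF _ lam(3)])
    then obtain \<beta>0 where \<beta>0: "\<beta>0 \<in> Field lam" "\<And>ws. ws \<in> ?W \<Longrightarrow> (\<beta> ws, \<beta>0) \<in> lam"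
      using regularCard_bounded[OF lam(1,2), of ?W \<beta>] \<beta>(1) by blast
    have "f ` {j. strictly_less lam \<beta>0 j} \<subseteq> Pow I"
      by (auto simp: f_def I_def)
    from shatters_large_family[OF \<kappa> \<delta> ded I this large[OF \<beta>0(1)], of n]
    obtain w where w: "w \<subseteq> I" "finite w" "card w = n" "shatters (f ` {j. strictly_less lam \<beta>0 j}) w"
      by blast
    obtain ws where ws: "set ws = w" "distinct ws"
      using finite_distinct_list[OF w(2)] by blast
    then have "ws \<in> ?W" using w distinct_card[of ws] by auto
    moreover have "{j. strictly_less lam \<beta>0 j} \<subseteq> {j. strictly_less lam (\<beta> ws) j}"
      using strictly_less_trans[OF wo \<beta>0(2)[OF \<open>ws \<in> ?W\<close>]] by blast
    from shatters_mono[OF w(4) image_mono[OF this]]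
    have "shatters (f ` {j. strictly_less lam (\<beta> ws) j}) (set ws)"
      by (simp only: ws(1))
    ultimately show False
      using \<beta>(2) by blast
  qed
  \<comment> \<open>The terms of \<open>b\<close> along \<open>e\<close> become the second sequence
    in the failure of 2-dependence.\<close>
  obtain e :: "nat \<Rightarrow> 'l" where e: "\<And>k. increasing lam (map e [0..<k])"
    using increasing_sequence[OF lam(1) lam_inf] by blast
  have e_Field: "e j \<in> Field lam" for j
    using e[of "Suc j"] by (simp add: increasing_def)
  have "\<exists>as. length as = n \<and> set as \<subseteq> tuples M (concat (replicate p X)) \<and>
      (\<forall>k. independent M Z \<phi> as (map (\<lambda>j. b (e j)) [0..<k]))" for n
  proof -
    obtain ws where ws: "set ws \<subseteq> I" "length ws = n" "distinct ws"
      "\<And>\<beta>. \<beta> \<in> Field lam \<Longrightarrow> shatters (f ` {j. strictly_less lam \<beta> j}) (set ws)"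
      using shattered[of n] by blast
    define as where "as = map (\<lambda>t. concat (map a t)) ws"
    have as: "set as \<subseteq> tuples M (concat (replicate p X))"
    proof -
      have "concat (map a t) \<in> tuples M (concat (replicate p X))" if "t \<in> set ws" for t
      proof -
        have "set t \<subseteq> Field \<kappa>" "length t = p" using that ws(1) by (auto simp: I_def)
        then show ?thesis
          unfolding tuples_replicate using a by (intro exI[of _ "map a t"]) auto
      qed
      then show ?thesis by (auto simp: as_def)
    qed
    have as_coords: "set (concat as) \<subseteq> coords (a ` Field \<kappa>)"
      using ws(1) by (fastforce simp: as_def coords_def I_def)
    have "independent M Z \<phi> as (map b (map e [0..<k]))" for k
    proof (rule independent_of_indiscernible[OF indisc \<phi> as as_coords b e])
      fix S :: "(nat \<times> nat) set"
      have "\<exists>j. strictly_less lam \<beta> j \<and> f j \<inter> set ws = V" if "\<beta> \<in> Field lam" "V \<subseteq> set ws" for \<beta> V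
        using ws(4)[OF that(1)] that(2) unfolding shatters_def by blast
      \<comment> \<open>The trace prescribed for the \<open>l\<close>-th term collects the index
        tuples \<open>ws ! s\<close> that \<open>S\<close> pairs with \<open>l\<close>. Any start in
        \<open>Field lam\<close> will do.\<close>
      from increasing_pattern[where f=f, OF wo this e_Field[of 0], of k "\<lambda>l. {ws ! s |s. s < n \<and> (s, l) \<in> S}"]
      obtain js where js: "length js = k" "increasing lam js"
        "\<And>l. l < k \<Longrightarrow> f (js ! l) \<inter> set ws = {ws ! s |s. s < n \<and> (s, l) \<in> S} \<inter> set ws"
        by blast
      have "sat M (c @ as ! s @ b (js ! l)) \<phi> \<longleftrightarrow> (s, l) \<in> S" if "s < n" "l < k" for s l
      proof -
        have s: "ws ! s \<in> set ws" using that ws(2) by simp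
        then have "ws ! s \<in> I" using ws(1) by blast
        then have "sat M (c @ as ! s @ b (js ! l)) \<phi> \<longleftrightarrow> ws ! s \<in> f (js ! l) \<inter> set ws"
          using that s ws(2) by (simp add: f_def I_def as_def)
        also have "\<dots> \<longleftrightarrow> (s, l) \<in> S"
          unfolding js(3)[OF that(2)] using s that ws(2,3) by (auto simp: nth_eq_iff_index_eq)
        finally show ?thesis .
      qed
      \<comment> \<open>Along \<open>js\<close> the witness is \<open>c\<close> itself; other tuples
        come in only with the transfer to \<open>e\<close>.\<close>
      then show "\<exists>is. increasing lam is \<and> length is = length (map e [0..<k]) \<and> (\<exists>z\<in>tuples M Z.
          \<forall>s<length as. \<forall>l<length (map e [0..<k]). sat M (z @ as ! s @ b (is ! l)) \<phi> \<longleftrightarrow> (s, l) \<in> S)"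
        using js(1,2) c ws(2) by (intro exI[of _ js] conjI bexI[of _ c]) (auto simp: as_def)
    qed
    then show ?thesis
      using as ws(2) by (intro exI[of _ as]) (simp add: as_def o_def)
  qed
  then have "extensible M Z (concat (replicate p X)) \<phi> (\<lambda>j. b (e j)) []"
    unfolding extensible_def by (metis append_Nil2 empty_set empty_subsetI)
  then have "not_two_dependent_formula TYPE('m) L T Z (concat (replicate p X)) Y \<phi>"
    using b[OF e_Field] by (intro not_two_dependent_if_extensible[OF assms(1) sat \<phi>])
  then show False
    using dep \<phi> unfolding two_dependent_def by blast
qed

text \<open>A formula has finitely many parameters, each a coordinate of \<open>c\<close> or of some
  \<open>a i\<close>. With one index chosen per parameter, it becomes a formula about
  \<open>c\<close>, the chosen terms and the given tuple.\<close>

lemma tp_eqI: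
  assumes struc: "is_struc L M"
    and a: "\<And>i. i \<in> I \<Longrightarrow> a i \<in> tuples M X"
    and b: "b \<in> tuples M Y" "b' \<in> tuples M Y"
    and c: "c \<in> tuples M Z"
    and eq: "\<And>p \<phi> t. \<phi> \<in> formulas L (Z @ concat (replicate p X) @ Y) \<Longrightarrow> set t \<subseteq> I \<Longrightarrow> length t = p \<Longrightarrow>
      sat M (c @ concat (map a t) @ b) \<phi> \<longleftrightarrow> sat M (c @ concat (map a t) @ b') \<phi>"
  shows "tp L M Y b {a i @ c |i. i \<in> I} = tp L M Y b' {a i @ c |i. i \<in> I}"
proof -
  have "sat M (b @ q) \<psi> \<longleftrightarrow> sat M (b' @ q) \<psi>"
    if \<psi>q: "(\<psi>, q) \<in> param_formulas L M Y (coords {a i @ c |i. i \<in> I})" for \<psi> q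
  proof -
    obtain Q where q: "set q \<subseteq> coords {a i @ c |i. i \<in> I}" "q \<in> tuples M Q" "\<psi> \<in> formulas L (Y @ Q)"
      using \<psi>q by (auto simp: param_formulas_def)
    define p where "p = length q"
    have "\<exists>i u. i \<in> I \<and> u < length (a i @ c) \<and> q ! n = (a i @ c) ! u" if "n < p" for n
    proof -
      have "q ! n \<in> coords {a i @ c |i. i \<in> I}" using q(1) that by (simp add: p_def subsetD)
      then obtain i where "i \<in> I" "q ! n \<in> set (a i @ c)" by (auto simp: coords_def)
      then show ?thesis by (metis in_set_conv_nth)
    qed
    then obtain i u where iu: "\<And>n. n < p \<Longrightarrow> i n \<in> I \<and> u n < length (a (i n) @ c) \<and> q ! n = (a (i n) @ c) ! u n"
      by metis
    define t where "t = map i [0..<p]"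
    have t: "set t \<subseteq> I" "length t = p" using iu by (auto simp: t_def)
    define Xs where "Xs = Z # replicate p X @ [Y]"
    define bl where "bl d = c # map a t @ [d]" for d
    \<comment> \<open>The address of parameter \<open>n\<close>: \<open>c\<close> is block 0, the
      term chosen for parameter \<open>n\<close> is block \<open>Suc n\<close>, and the given tuple
      is block \<open>Suc p\<close>.\<close>
    define ku where "ku n = (if u n < length X then (Suc n, u n) else (0, u n - length X))" for n
    define kus where "kus = map (Pair (Suc p)) [0..<length Y] @ map ku [0..<p]"
    have bl: "list_all2 (\<lambda>as X. as \<in> tuples M X) (bl d) Xs" if "d \<in> tuples M Y" for d
      unfolding bl_def Xs_def using that a c t
      by (auto intro!: list_all2_appendI simp: list_all2_replicate_iff subset_iff)
    have Q: "length Q = p" using length_tuples[OF q(2)] by (simp add: p_def)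
    have ku: "(case ku n of (k, v) \<Rightarrow> k < length Xs \<and> v < length (Xs ! k) \<and> Xs ! k ! v = Q ! n) \<and>
        (case ku n of (k, v) \<Rightarrow> bl d ! k ! v) = q ! n"
      if n: "n < p" for n d
    proof -
      have len: "length (a (i n)) = length X" "length c = length Z"
        using a iu[OF n] c length_tuples by blast+
      have qn: "q ! n \<in> sort_dom M (Q ! n)"
        using q(2) n Q by (auto simp: tuples_def list_all2_conv_all_nth)
      have un: "u n < length X + length Z" "q ! n = (a (i n) @ c) ! u n"
        using iu[OF n] len by auto
      show ?thesis
      proof (cases "u n < length X")
        case True
        then have "q ! n \<in> sort_dom M (X ! u n)"
          using un(2) a[of "i n"] iu[OF n] by (auto simp: nth_append len tuples_def list_all2_conv_all_nth)
        \<comment> \<open>Sorts are disjoint, so an element lying in both sort domains shows that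
          the sorts agree.\<close>
        then have "X ! u n = Q ! n"
          using qn struc unfolding is_struc_def by blast
        then show ?thesis
          using True n un(2) by (simp add: ku_def Xs_def bl_def t_def nth_append len)
      next
        case False
        then have "q ! n \<in> sort_dom M (Z ! (u n - length X))"
          using un c by (auto simp: nth_append len tuples_def list_all2_conv_all_nth)
        then have "Z ! (u n - length X) = Q ! n"
          using qn struc unfolding is_struc_def by blast
        then show ?thesis
          using False n un by (simp add: ku_def Xs_def bl_def nth_append len)
      qed
    qed
    have "list_all2 (\<lambda>(k, v) s. k < length Xs \<and> v < length (Xs ! k) \<and> Xs ! k ! v = s) kus (Y @ Q)"
      unfolding kus_def
    proof (rule list_all2_appendI)
      show "list_all2 (\<lambda>(k, v) s. k < length Xs \<and> v < length (Xs ! k) \<and> Xs ! k ! v = s)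
        (map (Pair (Suc p)) [0..<length Y]) Y"
        by (auto simp: list_all2_conv_all_nth Xs_def nth_append)
      show "list_all2 (\<lambda>(k, v) s. k < length Xs \<and> v < length (Xs ! k) \<and> Xs ! k ! v = s)
        (map ku [0..<p]) Q"
        unfolding list_all2_conv_all_nth using Q ku by (simp add: split_beta)
    qed
    moreover have "set (concat Xs) \<subseteq> sorts L"
      using tuples_sorts[OF struc tuples_concat[OF bl[OF b(1)]]] .
    ultimately obtain \<phi> where \<phi>: "\<phi> \<in> formulas L (concat Xs)"
      "\<And>bs. list_all2 (\<lambda>as X. as \<in> tuples M X) bs Xs \<Longrightarrow>
        sat M (concat bs) \<phi> \<longleftrightarrow> sat M (map (\<lambda>(k, v). bs ! k ! v) kus) \<psi>"
      using pick_coordinates[OF q(3), of Xs kus M] by blast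
    have "map (\<lambda>(k, v). bl d ! k ! v) kus = d @ q" if "d \<in> tuples M Y" for d
    proof -
      have "map (\<lambda>(k, v). bl d ! k ! v) (map (Pair (Suc p)) [0..<length Y]) = d"
        using that by (intro nth_equalityI) (simp_all add: bl_def nth_append t length_tuples)
      moreover have "map (\<lambda>(k, v). bl d ! k ! v) (map ku [0..<p]) = q"
        using ku by (intro nth_equalityI) (simp_all add: p_def)
      ultimately show ?thesis by (simp only: kus_def map_append)
    qed
    then have "sat M (c @ concat (map a t) @ d) \<phi> \<longleftrightarrow> sat M (d @ q) \<psi>" if "d \<in> tuples M Y" for d
      using \<phi>(2)[OF bl[OF that]] that by (simp add: bl_def)
    then show ?thesis
      using eq[of \<phi> p t] \<phi>(1) t b by (simp add: Xs_def)
  qed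
  then show ?thesis by (auto simp: tp_def)
qed

section \<open>Cardinalities of sets of formulas and of families of types\<close>

lemma infinite_formulas:
  fixes L :: "('s, 'f, 'r) lang"
  shows "infinite (\<Union>\<Gamma>. formulas L \<Gamma>)"
proof -
  \<comment> \<open>Iterated negations of \<open>Bot\<close> are sentences of every
    language.\<close>
  have "inj (\<lambda>n. (Neg ^^ n) (Bot :: ('s, 'f, 'r) fm))"
  proof (rule injI)
    fix m n assume "(Neg ^^ m) (Bot :: ('s, 'f, 'r) fm) = (Neg ^^ n) Bot"
    then show "m = n"
    proof (induction m arbitrary: n)
      case 0
      then show ?case by (cases n) auto
    next
      case (Suc m)
      then show ?case by (cases n) auto
    qed
  qed
  moreover have "(Neg ^^ n) Bot \<in> formulas L []" for n
    by (induction n) (auto simp: formulas_def)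
  then have "range (\<lambda>n. (Neg ^^ n) Bot) \<subseteq> (\<Union>\<Gamma>. formulas L \<Gamma>)"
    by auto
  ultimately show ?thesis
    unfolding infinite_iff_countable_subset by blast
qed

text \<open>There is one context for each \<open>p\<close>, hence a countable union of sets of at
  most \<open>card_theory L\<close> formulas, and \<open>card_theory L\<close> is infinite.\<close>

lemma card_of_formula_contexts:
  "|SIGMA p : (UNIV :: nat set). formulas L (C p)| \<le>o card_theory L"
  unfolding card_theory_def
proof (rule card_of_Sigma_ordLeq_infinite[OF infinite_formulas])
  show "|UNIV :: nat set| \<le>o |\<Union>\<Gamma>. formulas L \<Gamma>|"
    using infinite_formulas infinite_iff_card_of_nat by blast
  show "\<forall>p\<in>UNIV. |formulas L (C p)| \<le>o |\<Union>\<Gamma>. formulas L \<Gamma>|"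
    by (blast intro: card_of_mono1)
qed

text \<open>\<open>g j\<close> is determined by the family of the values \<open>f x j\<close>; with
  the values coded in \<open>\<delta>\<close>, this family is a function from \<open>A\<close> to
  \<open>\<delta>\<close>.\<close>

lemma card_of_joint_image:
  assumes "\<And>x. x \<in> A \<Longrightarrow> |f x ` J| \<le>o \<delta>"
    and "\<And>j j'. j \<in> J \<Longrightarrow> j' \<in> J \<Longrightarrow> (\<And>x. x \<in> A \<Longrightarrow> f x j = f x j') \<Longrightarrow> g j = g j'"
  shows "|g ` J| \<le>o \<delta> ^c |A|"
proof -
  have "\<exists>h. inj_on h (f x ` J) \<and> h ` f x ` J \<subseteq> Field \<delta>" if "x \<in> A" for x
    using card_of_mono2[OF assms(1)[OF that]] by (simp add: card_of_ordLeq Field_card_of)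
  then obtain h where h: "\<And>x. x \<in> A \<Longrightarrow> inj_on (h x) (f x ` J)" "\<And>x. x \<in> A \<Longrightarrow> h x ` f x ` J \<subseteq> Field \<delta>"
    by metis
  \<comment> \<open>Membership in \<open>Func\<close> requires the value \<open>undefined\<close>
    outside of \<open>A\<close>.\<close>
  define G where "G j = (\<lambda>x. if x \<in> A then h x (f x j) else undefined)" for j
  have "|g ` J| \<le>o |G ` J|"
  proof (rule card_of_image_factor)
    fix j j' assume j: "j \<in> J" "j' \<in> J" "G j = G j'"
    show "g j = g j'"
    proof (rule assms(2)[OF j(1,2)])
      fix x assume x: "x \<in> A"
      then have "h x (f x j) = h x (f x j')"
        using fun_cong[OF j(3), of x] by (simp add: G_def)
      then show "f x j = f x j'"
        using h(1)[OF x] j by (auto dest: inj_onD)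
    qed
  qed
  also have "|G ` J| \<le>o |Func A (Field \<delta>)|"
    using h(2) by (intro card_of_mono1) (fastforce simp: G_def Func_def)
  finally show ?thesis by (simp add: cexp_def Field_card_of)
qed

theorem proposition5p6:
  fixes L :: "('s, 'f, 'r) lang"
    and T :: "('s, 'f, 'r) fm set"
    and M :: "('s, 'f, 'r, 'm) struc"
    and \<mu> :: "'u rel"
    and \<kappa> :: "'k rel"
    and lam :: "'l rel"
    and X Y Z :: "'s list"
    and a :: "'k \<Rightarrow> 'm list"
    and b :: "'l \<Rightarrow> 'm list"
    and c :: "'m list"
  assumes "is_lang L"
    and "complete_theory TYPE('m) L T"
    and "monster L T \<mu> M" and "\<kappa> <o \<mu>" and "lam <o \<mu>"
    and "two_dependent TYPE('m) L T"
    and "Card_order \<kappa>" and "infinite (Field \<kappa>)" and "card_theory L \<le>o \<kappa>"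
    and "Card_order lam" and "regularCard lam" and "\<kappa> <o lam"
    and "\<forall>i\<in>Field \<kappa>. a i \<in> tuples M X"
    and "\<forall>j\<in>Field lam. b j \<in> tuples M Y"
    and "c \<in> tuples M Z"
    and "mutually_indiscernible L M X \<kappa> a Y lam b"
  shows "\<exists>\<beta>\<in>Field lam.
    |realized_types L M Y {b j |j. j \<in> Field lam \<and> strictly_less lam \<beta> j}
       {a i @ c |i. i \<in> Field \<kappa>}| \<le>o ded \<kappa> ^c card_theory L"
proof -
  have model: "is_model L T M" and sat: "saturated L \<mu> M" "natLeq <o \<mu>"
    using assms(3) by (auto simp: monster_def strongly_inaccessible_def)
  have struc: "is_struc L M" using model by (simp add: is_model_def)
  have ded: "Card_order (ded \<kappa>)"
    "\<And>R. linear_order_on (Field \<kappa>) R \<Longrightarrow> |cuts (Field \<kappa>) R| \<le>o ded \<kappa>"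
    using is_ded_ded[of \<kappa>] by (auto simp: is_ded_def)
  have wo: "Well_order lam" using assms(10) by (rule Card_order_wo_rel[unfolded wo_rel_def])
  have indisc: "indiscernible_over L M Y lam b (coords (a ` Field \<kappa>))"
    using assms(16) by (simp add: mutually_indiscernible_def)
  \<comment> \<open>All \<open>p\<close> are taken together, because the formulas of a type have
    arbitrarily many parameters.\<close>
  define \<Theta> where "\<Theta> = (SIGMA p : (UNIV :: nat set). formulas L (Z @ concat (replicate p X) @ Y))"
  have \<Theta>: "|\<Theta>| \<le>o card_theory L"
    unfolding \<Theta>_def by (rule card_of_formula_contexts)
  define f where "f = (\<lambda>(p, \<phi>) j. {t. set t \<subseteq> Field \<kappa> \<and> length t = p \<and> sat M (c @ concat (map a t) @ b j) \<phi>})"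
  have "\<exists>\<beta>. \<beta> \<in> Field lam \<and> |f \<theta> ` {j. strictly_less lam \<beta> j}| \<le>o ded \<kappa>" if \<theta>\<Theta>: "\<theta> \<in> \<Theta>" for \<theta>
  proof -
    obtain p \<phi> where \<theta>: "\<theta> = (p, \<phi>)" "\<phi> \<in> formulas L (Z @ concat (replicate p X) @ Y)"
      using \<theta>\<Theta> by (auto simp: \<Theta>_def)
    have "\<exists>\<beta>\<in>Field lam. |f \<theta> ` {j. strictly_less lam \<beta> j}| \<le>o ded \<kappa>"
      by (rule few_traces[OF model sat assms(6,7,8,10,11,12) ded _ _ assms(15) indisc \<theta>(2)])
        (use assms(13,14) in \<open>auto simp: f_def \<theta>(1)\<close>)
    then show ?thesis by blast
  qed
  then obtain \<beta> where \<beta>: "\<And>\<theta>. \<theta> \<in> \<Theta> \<Longrightarrow> \<beta> \<theta> \<in> Field lam"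
    "\<And>\<theta>. \<theta> \<in> \<Theta> \<Longrightarrow> |f \<theta> ` {j. strictly_less lam (\<beta> \<theta>) j}| \<le>o ded \<kappa>"
    by metis
  have "|\<Theta>| <o lam"
    by (rule ordLeq_ordLess_trans[OF ordLeq_transitive[OF \<Theta> assms(9)] assms(12)])
  \<comment> \<open>By regularity one index bounds all those found for the single formulas, and the
    tail beyond it is contained in each of theirs.\<close>
  then obtain \<beta>0 where \<beta>0: "\<beta>0 \<in> Field lam" "\<And>\<theta>. \<theta> \<in> \<Theta> \<Longrightarrow> (\<beta> \<theta>, \<beta>0) \<in> lam"
    using regularCard_bounded[OF assms(10,11), of \<Theta> \<beta>] \<beta>(1) by blast
  define J where "J = {j. strictly_less lam \<beta>0 j}"
  have J: "j \<in> Field lam" if "j \<in> J" for j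
    using that by (auto simp: J_def strictly_less_def Field_def)
  define g where "g j = tp L M Y (b j) {a i @ c |i. i \<in> Field \<kappa>}" for j
  have "|g ` J| \<le>o ded \<kappa> ^c |\<Theta>|"
  proof (rule card_of_joint_image)
    fix \<theta> assume \<theta>: "\<theta> \<in> \<Theta>"
    have "J \<subseteq> {j. strictly_less lam (\<beta> \<theta>) j}"
      using strictly_less_trans[OF wo \<beta>0(2)[OF \<theta>]] by (auto simp: J_def)
    then show "|f \<theta> ` J| \<le>o ded \<kappa>"
      by (intro ordLeq_transitive[OF card_of_mono1 \<beta>(2)[OF \<theta>]] image_mono)
  next
    fix j j' assume j: "j \<in> J" "j' \<in> J" and eq: "\<And>\<theta>. \<theta> \<in> \<Theta> \<Longrightarrow> f \<theta> j = f \<theta> j'"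
    show "g j = g j'"
      unfolding g_def
    proof (rule tp_eqI[OF struc _ _ _ assms(15)])
      fix p \<phi> t assume \<phi>: "\<phi> \<in> formulas L (Z @ concat (replicate p X) @ Y)"
        and t: "set t \<subseteq> Field \<kappa>" "length t = p"
      have "t \<in> f (p, \<phi>) j \<longleftrightarrow> t \<in> f (p, \<phi>) j'"
        using eq[of "(p, \<phi>)"] \<phi> by (simp add: \<Theta>_def)
      then show "sat M (c @ concat (map a t) @ b j) \<phi> \<longleftrightarrow> sat M (c @ concat (map a t) @ b j') \<phi>"
        using t by (simp add: f_def)
    qed (use assms(13,14) J j in auto)
  qed
  \<comment> \<open>Passing from an empty exponent to a nonempty one would decrease the power of an
    empty base, so \<open>\<Theta>\<close> is shown to be nonempty.\<close>
  also have "ded \<kappa> ^c |\<Theta>| \<le>o ded \<kappa> ^c card_theory L"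
  proof (rule cexp_mono2'[OF \<Theta> ded(1)])
    assume "Field |\<Theta>| = {}"
    \<comment> \<open>For \<open>p = 0\<close> the context consists of \<open>Z\<close> and
      \<open>Y\<close>, whose sorts belong to the language because there are tuples of these
      sorts.\<close>
    moreover have "(0, Bot) \<in> \<Theta>"
    proof -
      obtain j where "j \<in> Field lam" using \<beta>0(1) by blast
      then have "set Y \<subseteq> sorts L" "set Z \<subseteq> sorts L"
        using tuples_sorts[OF struc] assms(14,15) by blast+
      then show ?thesis by (simp add: \<Theta>_def formulas_def)
    qed
    ultimately show "Field (card_theory L) = {}"
      by (auto simp: Field_card_of)
  qed
  finally have "|g ` J| \<le>o ded \<kappa> ^c card_theory L" .
  moreover have "realized_types L M Y {b j |j. j \<in> Field lam \<and> strictly_less lam \<beta>0 j}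
      {a i @ c |i. i \<in> Field \<kappa>} = g ` J"
    using J by (auto simp: realized_types_def g_def J_def)
  ultimately show ?thesis
    by (intro bexI[OF _ \<beta>0(1)]) (simp only:)
qed

end
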